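(* Let $m\geq 1$ be an integer and let $q_1,\dots,q_m\in[1,2]$. The following assertions are equivalent: (1) There is a constant $C_{q_1\ldots q_m}\geq 1$ such that $$\left(\sum_{i_1=1}^{\infty}\left(\sum_{i_2=1}^{\infty}\left(\cdots\left(\sum_{i_{m-1}=1}^{\infty}\left(\sum_{i_m=1}^{\infty}\left|A(e_{i_1},\dots,e_{i_m})\right|^{q_m}\right)^{\frac{q_{m-1}}{q_m}}\right)^{\frac{q_{m-2}}{q_{m-1}}}\cdots\right)^{\frac{q_2}{q_3}}\right)^{\frac{q_1}{q_2}}\right)^{\frac{1}{q_1}}\leq C_{q_1\ldots q_m}\|A\|$$ for all continuous $m$-linear forms $A:c_0\times\cdots\times c_0\to\mathbb{K}$. (2) $\frac{1}{q_1}+\cdots+\frac{1}{q_m}\leq\frac{m+1}{2}$.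
   Context: $\mathbb{K}$ denotes the field of real or complex scalars, $c_0$ is the space of null sequences in $\mathbb{K}$ with the sup norm, and $(e_i)_{i\ge 1}$ are its canonical unit vectors. $\|A\|=\sup\{|A(x_1,\dots,x_m)|:\ \|x_j\|\le 1 \text{ for all } j\}$. *)

theory Defs
  imports "HOL-Analysis.Analysis"
begin

text \<open>
  The scalar field is a type parameter \<open>'k\<close>, to be instantiated with \<^typ>\<open>real\<close> and
  \<^typ>\<open>complex\<close>. Sequences are indexed from 0, so the unit vectors are \<open>e\<^sub>0, e\<^sub>1, \<dots>\<close>;
  the arguments of an \<open>m\<close>-linear form are indexed by \<open>{1..m}\<close>.
\<close>

definition c0 :: "(nat \<Rightarrow> 'k::real_normed_field) set"
  where "c0 = {x. x \<longlonglongrightarrow> 0}"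

definition sup_norm :: "(nat \<Rightarrow> 'k::real_normed_field) \<Rightarrow> real"
  where "sup_norm x = (SUP n. norm (x n))"

definition c0_dist :: "(nat \<Rightarrow> 'k::real_normed_field) \<Rightarrow> (nat \<Rightarrow> 'k) \<Rightarrow> real"
  where "c0_dist x y = sup_norm (\<lambda>n. x n - y n)"

text \<open>
  The locale \<open>Metric_space\<close> requires symmetry and nonnegativity of the distance on the whole type.
  The supremum of an unbounded set of reals is unspecified, so the distance
  is cut off to 0 outside \<^const>\<open>c0\<close>.
\<close>

definition c0_metric :: "(nat \<Rightarrow> 'k::real_normed_field) metric"
  where "c0_metric = metric (c0, \<lambda>x y. if x \<in> c0 \<and> y \<in> c0 then c0_dist x y else 0)"

definition unit_vec :: "nat \<Rightarrow> nat \<Rightarrow> 'k::real_normed_field"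
  where "unit_vec i = (\<lambda>n. if n = i then 1 else 0)"

lemma c0_bdd: "x \<in> c0 \<Longrightarrow> bdd_above (range (\<lambda>n. norm (x n)))"
  unfolding c0_def
  by (metis Bseq_eq_bounded bounded_imp_bdd_above bounded_norm_comp convergentI
      convergent_imp_Bseq mem_Collect_eq)

lemma norm_le_sup_norm: "x \<in> c0 \<Longrightarrow> norm (x n) \<le> sup_norm x"
  unfolding sup_norm_def by (rule cSUP_upper[OF _ c0_bdd]) auto

lemma c0_add: "x \<in> c0 \<Longrightarrow> y \<in> c0 \<Longrightarrow> (\<lambda>n. x n + y n) \<in> c0"
  unfolding c0_def using tendsto_add_zero by auto

lemma c0_diff: "x \<in> c0 \<Longrightarrow> y \<in> c0 \<Longrightarrow> (\<lambda>n. x n - y n) \<in> c0"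
  unfolding c0_def using tendsto_diff[of x 0 _ y 0] by auto

lemma c0_scale: "x \<in> c0 \<Longrightarrow> (\<lambda>n. a * x n) \<in> c0"
  unfolding c0_def using tendsto_mult_right_zero by auto

lemma unit_vec_in_c0: "unit_vec i \<in> c0"
proof -
  have "eventually (\<lambda>n. unit_vec i n = (0::'a)) sequentially"
    unfolding unit_vec_def eventually_sequentially by (rule exI[of _ "Suc i"]) auto
  then show ?thesis unfolding c0_def by (simp add: tendsto_eventually)
qed

lemma sup_norm_nonneg: "x \<in> c0 \<Longrightarrow> 0 \<le> sup_norm x"
  using norm_le_sup_norm[of x 0] norm_ge_zero order_trans by blast

lemma Metric_space_c0:
  "Metric_space c0 (\<lambda>x y. if x \<in> c0 \<and> y \<in> c0 then c0_dist x y else 0)"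
proof
  fix x y :: "nat \<Rightarrow> 'a"
  show "0 \<le> (if x \<in> c0 \<and> y \<in> c0 then c0_dist x y else 0)"
    by (simp add: c0_dist_def c0_diff sup_norm_nonneg)
  show "(if x \<in> c0 \<and> y \<in> c0 then c0_dist x y else 0) =
        (if y \<in> c0 \<and> x \<in> c0 then c0_dist y x else 0)"
    by (simp add: c0_dist_def sup_norm_def norm_minus_commute)
next
  fix x y :: "nat \<Rightarrow> 'a"
  assume xy: "x \<in> c0" "y \<in> c0"
  have "c0_dist x y = 0 \<longleftrightarrow> x = y"
  proof
    assume "c0_dist x y = 0"
    then have "norm (x n - y n) \<le> 0" for n
      using norm_le_sup_norm[OF c0_diff[OF xy], of n] by (simp add: c0_dist_def)
    then show "x = y" by auto
  qed (simp add: c0_dist_def sup_norm_def)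
  then show "(if x \<in> c0 \<and> y \<in> c0 then c0_dist x y else 0) = 0 \<longleftrightarrow> x = y"
    using xy by simp
next
  fix x y z :: "nat \<Rightarrow> 'a"
  assume xyz: "x \<in> c0" "y \<in> c0" "z \<in> c0"
  have "norm (x n - z n) \<le> c0_dist x y + c0_dist y z" for n
    using norm_le_sup_norm[OF c0_diff[OF xyz(1,2)], of n]
      norm_le_sup_norm[OF c0_diff[OF xyz(2,3)], of n]
      norm_triangle_ineq[of "x n - y n" "y n - z n"]
    by (simp add: c0_dist_def)
  then have "c0_dist x z \<le> c0_dist x y + c0_dist y z"
    unfolding c0_dist_def[of x z] sup_norm_def by (intro cSUP_least) auto
  then show "(if x \<in> c0 \<and> z \<in> c0 then c0_dist x z else 0)
      \<le> (if x \<in> c0 \<and> y \<in> c0 then c0_dist x y else 0)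
       + (if y \<in> c0 \<and> z \<in> c0 then c0_dist y z else 0)"
    using xyz by simp
qed

lemma mspace_c0_metric [simp]: "mspace c0_metric = c0"
  unfolding c0_metric_def using Metric_space_c0 by (rule Metric_space.mspace_metric)

lemma mdist_c0_metric:
  "x \<in> c0 \<Longrightarrow> y \<in> c0 \<Longrightarrow> mdist c0_metric x y = c0_dist x y"
  unfolding c0_metric_def by (simp add: Metric_space.mdist_metric[OF Metric_space_c0])

definition tuples :: "nat \<Rightarrow> (nat \<Rightarrow> nat \<Rightarrow> 'k::real_normed_field) set"
  where "tuples m = (\<Pi>\<^sub>E j\<in>{1..m}. c0)"

definition multilinear_form :: "nat \<Rightarrow> ((nat \<Rightarrow> nat \<Rightarrow> 'k::real_normed_field) \<Rightarrow> 'k) \<Rightarrow> bool"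
  where "multilinear_form m A \<longleftrightarrow>
    (\<forall>x\<in>tuples m. \<forall>j\<in>{1..m}. \<forall>y\<in>c0. \<forall>z\<in>c0. \<forall>a b.
      A (x(j := (\<lambda>n. a * y n + b * z n))) = a * A (x(j := y)) + b * A (x(j := z)))"

definition continuous_multilinear_form ::
  "nat \<Rightarrow> ((nat \<Rightarrow> nat \<Rightarrow> 'k::real_normed_field) \<Rightarrow> 'k) \<Rightarrow> bool"
  where "continuous_multilinear_form m A \<longleftrightarrow>
    multilinear_form m A \<and>
    continuous_map (product_topology (\<lambda>_. mtopology_of c0_metric) {1..m}) euclidean A"

text \<open>A real supremum: the set is bounded above when \<open>A\<close> is continuous and multilinear.\<close>

definition form_norm :: "nat \<Rightarrow> ((nat \<Rightarrow> nat \<Rightarrow> 'k::real_normed_field) \<Rightarrow> 'k) \<Rightarrow> real"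
  where "form_norm m A =
    (SUP x\<in>{x \<in> tuples m. \<forall>j\<in>{1..m}. sup_norm (x j) \<le> 1}. norm (A x))"

text \<open>Power with a positive real exponent on \<open>[0, \<infinity>]\<close>.\<close>

definition ennpow :: "ennreal \<Rightarrow> real \<Rightarrow> ennreal"
  where "ennpow x p = (if x = \<infinity> then \<infinity> else ennreal (enn2real x powr p))"

text \<open>
  \<open>nested_sum m q a k i\<close> is the sum over the indices with positions \<open>k, \<dots>, m\<close>, the indices
  \<open>i 1, \<dots>, i (k - 1)\<close> being fixed:
  \<open>S\<^sub>m = \<Sum>i\<^sub>m. a(i)\<^bsup>q\<^sub>m\<^esup>\<close> and \<open>S\<^sub>k = \<Sum>i\<^sub>k. (S\<^sub>k\<^sub>+\<^sub>1)\<^bsup>q\<^sub>k/q\<^sub>k\<^sub>+\<^sub>1\<^esup>\<close> for \<open>k < m\<close>.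
  Sums are taken in \<open>[0, \<infinity>]\<close>, so that an upper bound on them includes convergence.
\<close>

function nested_sum ::
  "nat \<Rightarrow> (nat \<Rightarrow> real) \<Rightarrow> ((nat \<Rightarrow> nat) \<Rightarrow> real) \<Rightarrow> nat \<Rightarrow> (nat \<Rightarrow> nat) \<Rightarrow> ennreal"
  where "nested_sum m q a k i =
    (if k < m
     then (\<Sum>n. ennpow (nested_sum m q a (Suc k) (i(k := n))) (q k / q (Suc k)))
     else (\<Sum>n. ennpow (ennreal (a (i(k := n)))) (q k)))"
  by auto
termination
  by (relation "Wellfounded.measure (\<lambda>(m, q, a, k, i). m - k)") auto

declare nested_sum.simps [simp del]

text \<open>The starting value of \<open>i\<close> is irrelevant, all positions \<open>1, \<dots>, m\<close> being overwritten.\<close>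

definition mixed_sum ::
  "nat \<Rightarrow> (nat \<Rightarrow> real) \<Rightarrow> ((nat \<Rightarrow> nat \<Rightarrow> 'k::real_normed_field) \<Rightarrow> 'k) \<Rightarrow> ennreal"
  where "mixed_sum m q A =
    ennpow (nested_sum m q (\<lambda>i. norm (A (\<lambda>j\<in>{1..m}. unit_vec (i j)))) 1 (\<lambda>_. 0)) (1 / q 1)"

end

theory Submission
  imports Defs
begin

text \<open>
  Necessity: for signs \<open>h\<close> with orthogonal rows of length \<open>n = 2\<^sup>d\<close>, the form with coefficients
  \<open>h(i\<^sub>1, i\<^sub>2) h(i\<^sub>2, i\<^sub>3) \<dots> h(i\<^sub>m\<^sub>-\<^sub>1, i\<^sub>m)\<close> has norm at most \<open>n\<close> to the power \<open>(m + 1)/2\<close>, since \<open>h\<close> is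
  \<open>\<surd>n\<close> times an isometry and pointwise multiplication by the variables is a contraction, while all of its
  \<open>n\<^sup>m\<close> coefficients are unimodular. Let \<open>d\<close> tend to infinity.

  Sufficiency: if one exponent is 1 and the others are 2, Minkowski's inequality moves the exponent 1
  to the outermost position, and Khinchine's inequality replaces the inner \<open>\<ell>\<^sub>2\<close> sums one after
  the other by averages over signs; what remains is an \<open>\<ell>\<^sub>1\<close> sum in one variable, at most the
  norm of the form. Condition (2) says that \<open>2/q\<^sub>j - 1 \<ge> 0\<close> have sum at most 1, so that
  \<open>(1/q\<^sub>1, \<dots>, 1/q\<^sub>m)\<close> is a convex combination of the points \<open>(1/2, \<dots>, 1, \<dots>, 1/2)\<close> and
  \<open>(1/2, \<dots>, 1/2)\<close>, and Hoelder's inequality for mixed norms interpolates.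
\<close>

section \<open>Mixed norms of finite arrays\<close>

text \<open>Cutting off at \<open>N\<close> keeps every norm a finite real sum; the limit over
  \<open>N\<close> is taken only in \<open>nested_sum_le_SUP\<close>.\<close>

definition lp_norm :: "nat \<Rightarrow> real \<Rightarrow> (nat \<Rightarrow> real) \<Rightarrow> real"
  where "lp_norm N p f = (\<Sum>n<N. f n powr p) powr (1 / p)"

lemma lp_norm_nonneg [simp]: "0 \<le> lp_norm N p f"
  by (simp add: lp_norm_def)

lemma lp_norm_one: "(\<And>n. 0 \<le> f n) \<Longrightarrow> lp_norm N 1 f = sum f {..<N}"
  by (simp add: lp_norm_def sum_nonneg)

lemma lp_norm_two: "(\<And>n. 0 \<le> f n) \<Longrightarrow> lp_norm N 2 f = L2_set f {..<N}"
  by (simp add: lp_norm_def L2_set_def powr_half_sqrt sum_nonneg powr_numeral)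

lemma lp_norm_powr: "0 < p \<Longrightarrow> lp_norm N p f powr p = (\<Sum>n<N. f n powr p)"
  by (simp add: lp_norm_def powr_powr sum_nonneg)

lemma lp_norm_mono:
  assumes "0 < p" "\<And>n. n < N \<Longrightarrow> 0 \<le> f n" "\<And>n. n < N \<Longrightarrow> f n \<le> g n"
  shows "lp_norm N p f \<le> lp_norm N p g"
  unfolding lp_norm_def using assms by (intro powr_mono2 sum_mono sum_nonneg) auto

lemma lp_norm_mono_length:
  assumes "0 < p" "N \<le> N'"
  shows "lp_norm N p f \<le> lp_norm N' p f"
  unfolding lp_norm_def using assms by (intro powr_mono2 sum_mono2 sum_nonneg) auto

lemma lp_norm_scale:
  assumes "0 < p" "0 \<le> c" "\<And>n. 0 \<le> f n"
  shows "lp_norm N p (\<lambda>n. c * f n) = c * lp_norm N p f"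
proof -
  have "(\<Sum>n<N. (c * f n) powr p) = c powr p * (\<Sum>n<N. f n powr p)"
    using assms by (simp add: powr_mult sum_distrib_left)
  then show ?thesis
    using assms by (simp add: lp_norm_def powr_mult powr_powr sum_nonneg)
qed

lemma L2_set_sum_le:
  "finite T \<Longrightarrow> L2_set (\<lambda>n. \<Sum>t\<in>T. f t n) S \<le> (\<Sum>t\<in>T. L2_set (f t) S)"
proof (induction T rule: finite_induct)
  case (insert t T)
  then show ?case
    using L2_set_triangle_ineq[of "f t" "\<lambda>n. \<Sum>t\<in>T. f t n" S] by simp
qed (simp add: L2_set_def)

text \<open>Minkowski's inequality for the two exponents that occur at the interpolation endpoints:
  exponent 1 is a change of summation order, exponent 2 the triangle inequality for
  \<open>L2_set\<close>.\<close>

lemma lp_norm_sum_le: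
  assumes "p = 1 \<or> p = 2" "finite T" "\<And>t n. t \<in> T \<Longrightarrow> 0 \<le> f t n"
  shows "lp_norm N p (\<lambda>n. \<Sum>t\<in>T. f t n) \<le> (\<Sum>t\<in>T. lp_norm N p (f t))"
  using assms(1)
proof
  assume [simp]: "p = 1"
  show ?thesis
    using assms by (simp add: lp_norm_one sum_nonneg sum.swap[of _ T])
next
  assume [simp]: "p = 2"
  show ?thesis
    using assms L2_set_sum_le[OF assms(2), of f "{..<N}"] by (simp add: lp_norm_two sum_nonneg)
qed

text \<open>The head of the list is the outermost variable. A list of positions, rather than an
  interval, lets \<open>mixed_norm_move_one\<close> change the order of summation.\<close>

fun mixed_norm ::
  "nat \<Rightarrow> (nat \<Rightarrow> real) \<Rightarrow> nat list \<Rightarrow> ((nat \<Rightarrow> nat) \<Rightarrow> real) \<Rightarrow> (nat \<Rightarrow> nat) \<Rightarrow> real"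
  where
    "mixed_norm N p [] F i = F i"
  | "mixed_norm N p (j # js) F i = lp_norm N (p j) (\<lambda>n. mixed_norm N p js F (i(j := n)))"

lemma mixed_norm_nonneg: "(\<And>i. 0 \<le> F i) \<Longrightarrow> 0 \<le> mixed_norm N p js F i"
  by (induction js arbitrary: i) auto

lemma mixed_norm_append:
  "mixed_norm N p (js @ ls) F i = mixed_norm N p js (mixed_norm N p ls F) i"
  by (induction js arbitrary: i) auto

lemma mixed_norm_cong:
  "(\<And>j. j \<in> set js \<Longrightarrow> p j = p' j) \<Longrightarrow> mixed_norm N p js F i = mixed_norm N p' js F i"
  by (induction js arbitrary: i) auto

lemma mixed_norm_mono:
  assumes "\<And>j. j \<in> set js \<Longrightarrow> 0 < p j" "\<And>i. 0 \<le> F i" "\<And>i. F i \<le> G i"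
  shows "mixed_norm N p js F i \<le> mixed_norm N p js G i"
  using assms by (induction js arbitrary: i) (auto intro!: lp_norm_mono mixed_norm_nonneg)

lemma mixed_norm_mono_length:
  assumes "\<And>j. j \<in> set js \<Longrightarrow> 0 < p j" "\<And>i. 0 \<le> F i" "N \<le> N'"
  shows "mixed_norm N p js F i \<le> mixed_norm N' p js F i"
  using assms(1)
proof (induction js arbitrary: i)
  case (Cons j js)
  have "mixed_norm N p (j # js) F i \<le> lp_norm N (p j) (\<lambda>n. mixed_norm N' p js F (i(j := n)))"
    using Cons assms by (auto intro!: lp_norm_mono mixed_norm_nonneg)
  also have "\<dots> \<le> mixed_norm N' p (j # js) F i"
    using Cons.prems assms by (auto intro!: lp_norm_mono_length)
  finally show ?case .
qed simp

lemma mixed_norm_scale: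
  assumes "\<And>j. j \<in> set js \<Longrightarrow> 0 < p j" "\<And>i. 0 \<le> F i" "0 \<le> c"
  shows "mixed_norm N p js (\<lambda>i. c * F i) i = c * mixed_norm N p js F i"
  using assms by (induction js arbitrary: i) (auto simp: lp_norm_scale mixed_norm_nonneg)

lemma mixed_norm_upd:
  "k \<notin> set js \<Longrightarrow> mixed_norm N p js F (i(k := n)) = mixed_norm N p js (\<lambda>i. F (i(k := n))) i"
  by (induction js arbitrary: i) (auto simp: fun_upd_twist)

lemma mixed_norm_sum_le:
  assumes "\<And>j. j \<in> set js \<Longrightarrow> p j = 1 \<or> p j = 2" "finite T" "\<And>t i. t \<in> T \<Longrightarrow> 0 \<le> F t i"
  shows "mixed_norm N p js (\<lambda>i. \<Sum>t\<in>T. F t i) i \<le> (\<Sum>t\<in>T. mixed_norm N p js (F t) i)"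
  using assms(1)
proof (induction js arbitrary: i)
  case (Cons j js)
  have "0 < p j"
    using Cons.prems[of j] by auto
  then have "mixed_norm N p (j # js) (\<lambda>i. \<Sum>t\<in>T. F t i) i
      \<le> lp_norm N (p j) (\<lambda>n. \<Sum>t\<in>T. mixed_norm N p js (F t) (i(j := n)))"
    using Cons assms by (auto intro!: lp_norm_mono mixed_norm_nonneg sum_nonneg)
  also have "\<dots> \<le> (\<Sum>t\<in>T. mixed_norm N p (j # js) (F t) i)"
    using Cons.prems assms by (auto intro!: lp_norm_sum_le mixed_norm_nonneg)
  finally show ?case .
qed simp

text \<open>With exponent 1, the norm in position \<open>k\<close> is a finite sum of nonnegative
  arrays, and the triangle inequality for the norms over \<open>js\<close> pulls this sum to the
  outside.\<close>

lemma mixed_norm_move_one: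
  assumes "p k = 1" "\<And>j. j \<in> set js \<Longrightarrow> p j = 1 \<or> p j = 2" "k \<notin> set js" "\<And>i. 0 \<le> F i"
  shows "mixed_norm N p (js @ k # ls) F i \<le> mixed_norm N p (k # js @ ls) F i"
proof -
  let ?G = "mixed_norm N p ls F"
  have G: "0 \<le> ?G i" for i
    using assms(4) by (rule mixed_norm_nonneg)
  have "mixed_norm N p (js @ k # ls) F i = mixed_norm N p js (\<lambda>i. \<Sum>n<N. ?G (i(k := n))) i"
  proof -
    have "mixed_norm N p (k # ls) F = (\<lambda>i. \<Sum>n<N. ?G (i(k := n)))"
      using G by (simp add: fun_eq_iff lp_norm_one assms(1))
    then show ?thesis
      by (simp add: mixed_norm_append)
  qed
  also have "\<dots> \<le> (\<Sum>n<N. mixed_norm N p js (\<lambda>i. ?G (i(k := n))) i)"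
    using assms G by (intro mixed_norm_sum_le) auto
  also have "\<dots> = mixed_norm N p (k # js @ ls) F i"
    using assms G by (simp add: mixed_norm_append lp_norm_one mixed_norm_nonneg mixed_norm_upd)
  finally show ?thesis .
qed

section \<open>Hoelder's inequality with weights and interpolation of mixed norms\<close>

lemma prod_powr_weights:
  fixes x :: real and w :: "'t \<Rightarrow> real"
  assumes "finite T" "sum w T = 1" "0 \<le> x"
  shows "(\<Prod>t\<in>T. x powr w t) = x"
proof (cases "x = 0")
  case True
  \<comment> \<open>In HOL \<open>0 powr w = 0\<close> for every \<open>w\<close>, also for
    \<open>w = 0\<close>; a single factor therefore makes the product vanish.\<close>
  have "T \<noteq> {}"
    using assms(2) by auto
  then show ?thesis
    using True assms(1) by (auto simp: ex_in_conv)
next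
  case False
  then show ?thesis
    using assms powr_sum[of x w T] by simp
qed

text \<open>Jensen's inequality for \<open>exp\<close> at the points \<open>ln (x t)\<close>. If
  some \<open>x t\<close> is 0, the product is 0 even when \<open>w t = 0\<close>, since
  \<open>0 powr 0 = 0\<close>.\<close>

lemma weighted_arith_geo_mean:
  fixes x w :: "'t \<Rightarrow> real"
  assumes "finite T" "sum w T = 1" "\<And>t. t \<in> T \<Longrightarrow> 0 \<le> w t" "\<And>t. t \<in> T \<Longrightarrow> 0 \<le> x t"
  shows "(\<Prod>t\<in>T. x t powr w t) \<le> (\<Sum>t\<in>T. w t * x t)"
proof (cases "\<exists>t\<in>T. x t = 0")
  case True
  then have "(\<Prod>t\<in>T. x t powr w t) = 0"
    using assms(1) by (auto intro!: prod_zero)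
  moreover have "0 \<le> (\<Sum>t\<in>T. w t * x t)"
    using assms by (simp add: sum_nonneg)
  ultimately show ?thesis
    by linarith
next
  case False
  have "T \<noteq> {}"
    using assms(2) by auto
  have pos: "0 < x t" if "t \<in> T" for t
    using False assms(4) that by (simp add: order_less_le)
  have "(\<Prod>t\<in>T. x t powr w t) = (\<Prod>t\<in>T. exp (w t * ln (x t)))"
    using pos by (intro prod.cong) (auto simp: powr_def dest: pos)
  also have "\<dots> = exp (\<Sum>t\<in>T. w t *\<^sub>R ln (x t))"
    using assms(1) by (simp add: exp_sum)
  also have "\<dots> \<le> (\<Sum>t\<in>T. w t * exp (ln (x t)))"
    using assms \<open>T \<noteq> {}\<close> by (intro convex_on_sum[OF _ _ exp_convex]) auto
  also have "\<dots> = (\<Sum>t\<in>T. w t * x t)"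
    using pos by (intro sum.cong) auto
  finally show ?thesis .
qed

text \<open>Each \<open>F t\<close> is normalised to have sum 1 over \<open>S\<close>, and the
  arithmetic-geometric inequality is applied at every \<open>n\<close>; summation then leaves the
  total weight 1. If some \<open>F t\<close> has sum 0, it vanishes on \<open>S\<close> and the left
  side is 0.\<close>

lemma Holder_weights:
  fixes F :: "'t \<Rightarrow> 'n \<Rightarrow> real"
  assumes "finite T" "sum w T = 1" "\<And>t. t \<in> T \<Longrightarrow> 0 \<le> w t" "\<And>t n. t \<in> T \<Longrightarrow> 0 \<le> F t n"
    and "finite S"
  shows "(\<Sum>n\<in>S. \<Prod>t\<in>T. F t n powr w t) \<le> (\<Prod>t\<in>T. (\<Sum>n\<in>S. F t n) powr w t)"
proof (cases "\<exists>t\<in>T. sum (F t) S = 0")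
  case True
  then obtain t where t: "t \<in> T" "sum (F t) S = 0"
    by blast
  then have "F t n = 0" if "n \<in> S" for n
    using assms that by (simp add: sum_nonneg_eq_0_iff)
  then have "(\<Sum>n\<in>S. \<Prod>t\<in>T. F t n powr w t) = 0"
    using t assms(1) by (intro sum.neutral ballI prod_zero) auto
  then show ?thesis
    by (simp add: prod_nonneg)
next
  case False
  have pos: "0 < sum (F t) S" if "t \<in> T" for t
    using False assms(4) that by (simp add: order_less_le sum_nonneg)
  let ?P = "\<Prod>t\<in>T. sum (F t) S powr w t"
  have "0 < ?P"
    using pos by (auto intro!: prod_pos) (metis less_irrefl pos)
  have "(\<Sum>n\<in>S. \<Prod>t\<in>T. F t n powr w t) = ?P * (\<Sum>n\<in>S. \<Prod>t\<in>T. (F t n / sum (F t) S) powr w t)"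
    unfolding sum_distrib_left prod.distrib[symmetric]
  proof (intro sum.cong prod.cong refl)
    fix n t assume "t \<in> T"
    then show "F t n powr w t = sum (F t) S powr w t * (F t n / sum (F t) S) powr w t"
      using pos[of t] assms(4)[of t] by (simp flip: powr_mult)
  qed
  also have "\<dots> \<le> ?P * (\<Sum>n\<in>S. \<Sum>t\<in>T. w t * (F t n / sum (F t) S))"
    using assms pos \<open>0 < ?P\<close>
    by (intro mult_left_mono sum_mono weighted_arith_geo_mean) (auto simp: less_imp_le)
  also have "(\<Sum>n\<in>S. \<Sum>t\<in>T. w t * (F t n / sum (F t) S)) = (\<Sum>t\<in>T. w t * (sum (F t) S / sum (F t) S))"
    by (subst sum.swap) (simp only: sum_distrib_left sum_divide_distrib)
  also have "\<dots> = (\<Sum>t\<in>T. w t)"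
    using pos by (intro sum.cong) (auto dest: pos)
  finally show ?thesis
    using assms(2) by simp
qed

text \<open>Induction on the list: the induction hypothesis bounds the norm over the inner variables
  by a product of powers, and Hoelder's inequality separates the factors in the outermost
  sum.\<close>

lemma mixed_norm_interpolate:
  fixes p :: "'t \<Rightarrow> nat \<Rightarrow> real"
  assumes T: "finite T" "sum \<theta> T = 1" "\<And>t. t \<in> T \<Longrightarrow> 0 \<le> \<theta> t"
    and p: "\<And>t j. t \<in> T \<Longrightarrow> j \<in> set js \<Longrightarrow> 0 < p t j"
    and q: "\<And>j. j \<in> set js \<Longrightarrow> 0 < q j" "\<And>j. j \<in> set js \<Longrightarrow> 1 / q j = (\<Sum>t\<in>T. \<theta> t / p t j)"
    and F: "\<And>i. 0 \<le> F i"
  shows "mixed_norm N q js F i \<le> (\<Prod>t\<in>T. mixed_norm N (p t) js F i powr \<theta> t)"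
  using p q
proof (induction js arbitrary: i)
  case Nil
  then show ?case
    using T F by (simp add: prod_powr_weights)
next
  case (Cons j js)
  have q: "0 < q j" and w: "1 / q j = (\<Sum>t\<in>T. \<theta> t / p t j)" and p: "\<And>t. t \<in> T \<Longrightarrow> 0 < p t j"
    using Cons.prems by auto
  \<comment> \<open>These weights turn \<open>(M powr \<theta> t) powr q j\<close> into
    \<open>(M powr p t j) powr ?w t\<close>; the hypothesis on \<open>1 / q j\<close> says that they
    sum to 1.\<close>
  let ?w = "\<lambda>t. \<theta> t * q j / p t j"
  let ?M = "\<lambda>t n. mixed_norm N (p t) js F (i(j := n))"
  have M: "0 \<le> ?M t n" for t n
    using F by (rule mixed_norm_nonneg)
  have w1: "sum ?w T = 1"
  proof -
    have "sum ?w T = q j * (\<Sum>t\<in>T. \<theta> t / p t j)"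
      by (simp add: sum_distrib_left mult_ac)
    then show ?thesis
      using q by (simp flip: w)
  qed
  have "mixed_norm N q (j # js) F i \<le> lp_norm N (q j) (\<lambda>n. \<Prod>t\<in>T. ?M t n powr \<theta> t)"
    using Cons q F by (auto intro!: lp_norm_mono mixed_norm_nonneg)
  also have "\<dots> = (\<Sum>n<N. \<Prod>t\<in>T. (?M t n powr p t j) powr ?w t) powr (1 / q j)"
  proof -
    have "(\<Prod>t\<in>T. ?M t n powr \<theta> t) powr q j = (\<Prod>t\<in>T. (?M t n powr p t j) powr ?w t)" for n
      unfolding prod_powr_distrib powr_powr
    proof (intro prod.cong refl)
      fix t assume "t \<in> T"
      from p[OF this] show "?M t n powr (\<theta> t * q j) = ?M t n powr (p t j * ?w t)"
        by simp
    qed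
    then show ?thesis
      by (simp add: lp_norm_def)
  qed
  also have "\<dots> \<le> (\<Prod>t\<in>T. (\<Sum>n<N. ?M t n powr p t j) powr ?w t) powr (1 / q j)"
  proof -
    have "0 \<le> ?w t" if "t \<in> T" for t
      using T(3)[OF that] p[OF that] q by simp
    then show ?thesis
      using q T(1) w1
      by (intro powr_mono2 Holder_weights sum_nonneg prod_nonneg) auto
  qed
  also have "\<dots> = (\<Prod>t\<in>T. mixed_norm N (p t) (j # js) F i powr \<theta> t)"
    unfolding prod_powr_distrib powr_powr mixed_norm.simps lp_norm_def
    using q by (intro prod.cong refl) simp
  finally show ?case .
qed

section \<open>Khinchine's inequality\<close>

text \<open>Sign patterns are coded by subsets \<open>T\<close>, so that the expectation over
  \<open>N\<close> independent signs is a sum over \<open>Pow {..<N}\<close> divided by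
  \<open>2 ^ N\<close>.\<close>

definition rsign :: "nat set \<Rightarrow> nat \<Rightarrow> real"
  where "rsign T l = (if l \<in> T then -1 else 1)"

section \<open>Moments of Rademacher sums\<close>

lemma sum_Pow_lessThan_Suc:
  fixes f :: "nat set \<Rightarrow> 'b::comm_monoid_add"
  shows "(\<Sum>T\<in>Pow {..<Suc N}. f T) = (\<Sum>T\<in>Pow {..<N}. f T + f (insert N T))"
proof -
  have "inj_on (insert N) (Pow {..<N})"
    by (auto simp: inj_on_def)
  moreover have "Pow {..<N} \<inter> insert N ` Pow {..<N} = {}"
    by auto
  ultimately show ?thesis
    by (simp add: lessThan_Suc Pow_insert sum.union_disjoint sum.reindex sum.distrib)
qed

lemma rademacher_sum_Suc:
  fixes a :: "nat \<Rightarrow> 'v::real_vector"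
  assumes "T \<subseteq> {..<N}"
  shows "(\<Sum>l<Suc N. rsign T l *\<^sub>R a l) = (\<Sum>l<N. rsign T l *\<^sub>R a l) + a N"
    and "(\<Sum>l<Suc N. rsign (insert N T) l *\<^sub>R a l) = (\<Sum>l<N. rsign T l *\<^sub>R a l) - a N"
proof -
  have "(\<Sum>l<N. rsign (insert N T) l *\<^sub>R a l) = (\<Sum>l<N. rsign T l *\<^sub>R a l)"
    by (intro sum.cong) (auto simp: rsign_def)
  then show "(\<Sum>l<Suc N. rsign (insert N T) l *\<^sub>R a l) = (\<Sum>l<N. rsign T l *\<^sub>R a l) - a N"
    by (simp add: rsign_def)
  show "(\<Sum>l<Suc N. rsign T l *\<^sub>R a l) = (\<Sum>l<N. rsign T l *\<^sub>R a l) + a N"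
    using assms by (auto simp: rsign_def)
qed

lemma parallelogram_norm:
  fixes u v :: "'v::real_inner"
  shows "(norm (u + v))\<^sup>2 + (norm (u - v))\<^sup>2 = 2 * (norm u)\<^sup>2 + 2 * (norm v)\<^sup>2"
  by (simp add: power2_norm_eq_inner inner_add inner_diff inner_commute)

text \<open>The two fourth powers are the squares of \<open>P + 2 * (u \<bullet> v)\<close> and
  \<open>P - 2 * (u \<bullet> v)\<close>. Their sum is
  \<open>2 * P^2 + 8 * (u \<bullet> v)^2\<close>, and Cauchy-Schwarz bounds the last term.\<close>

lemma parallelogram_norm_4:
  fixes u v :: "'v::real_inner"
  shows "norm (u + v) ^ 4 + norm (u - v) ^ 4
    \<le> 2 * norm u ^ 4 + 12 * (norm u)\<^sup>2 * (norm v)\<^sup>2 + 2 * norm v ^ 4"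
proof -
  define P where "P = (norm u)\<^sup>2 + (norm v)\<^sup>2"
  have "(u \<bullet> v)\<^sup>2 \<le> (norm u)\<^sup>2 * (norm v)\<^sup>2"
    using Cauchy_Schwarz_ineq[of u v] by (simp add: power2_norm_eq_inner)
  moreover have "norm (u + v) ^ 4 = (P + 2 * (u \<bullet> v))\<^sup>2"
  proof -
    have "norm (u + v) ^ 4 = ((norm (u + v))\<^sup>2)\<^sup>2"
      by simp
    also have "(norm (u + v))\<^sup>2 = P + 2 * (u \<bullet> v)"
      unfolding P_def power2_norm_eq_inner by (simp add: inner_add inner_commute)
    finally show ?thesis .
  qed
  moreover have "norm (u - v) ^ 4 = (P - 2 * (u \<bullet> v))\<^sup>2"
  proof -
    have "norm (u - v) ^ 4 = ((norm (u - v))\<^sup>2)\<^sup>2"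
      by simp
    also have "(norm (u - v))\<^sup>2 = P - 2 * (u \<bullet> v)"
      unfolding P_def power2_norm_eq_inner by (simp add: inner_diff inner_commute)
    finally show ?thesis .
  qed
  moreover have "P\<^sup>2 = norm u ^ 4 + 2 * (norm u)\<^sup>2 * (norm v)\<^sup>2 + norm v ^ 4"
    unfolding P_def by (simp add: power2_sum)
  ultimately show ?thesis
    by (simp add: power2_sum power2_diff)
qed

text \<open>Induction on \<open>N\<close>, the two signs of the last term being paired by the
  parallelogram law.\<close>

lemma rademacher_second_moment:
  fixes a :: "nat \<Rightarrow> 'v::real_inner"
  shows "(\<Sum>T\<in>Pow {..<N}. (norm (\<Sum>l<N. rsign T l *\<^sub>R a l))\<^sup>2) = 2 ^ N * (\<Sum>l<N. (norm (a l))\<^sup>2)"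
proof (induction N)
  case (Suc N)
  let ?S = "\<lambda>T. \<Sum>l<N. rsign T l *\<^sub>R a l"
  have "(\<Sum>T\<in>Pow {..<Suc N}. (norm (\<Sum>l<Suc N. rsign T l *\<^sub>R a l))\<^sup>2)
      = (\<Sum>T\<in>Pow {..<N}. (norm (?S T + a N))\<^sup>2 + (norm (?S T - a N))\<^sup>2)"
    unfolding sum_Pow_lessThan_Suc by (intro sum.cong refl) (simp only: Pow_iff rademacher_sum_Suc)
  also have "\<dots> = 2 * (\<Sum>T\<in>Pow {..<N}. (norm (?S T))\<^sup>2) + 2 * 2 ^ N * (norm (a N))\<^sup>2"
    by (simp add: parallelogram_norm sum.distrib card_Pow flip: sum_distrib_left)
  finally show ?case
    using Suc by (simp add: algebra_simps)
qed simp

text \<open>The mixed term from \<open>parallelogram_norm_4\<close> is evaluated by the second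
  moment. The constant 3 reproduces itself, because
  \<open>6 * s^2 + 12 * b^2 * s + 2 * b^4 \<le> 6 * (s + b^2)^2\<close>.\<close>

lemma rademacher_fourth_moment:
  fixes a :: "nat \<Rightarrow> 'v::real_inner"
  shows "(\<Sum>T\<in>Pow {..<N}. norm (\<Sum>l<N. rsign T l *\<^sub>R a l) ^ 4)
    \<le> 3 * 2 ^ N * (\<Sum>l<N. (norm (a l))\<^sup>2)\<^sup>2"
proof (induction N)
  case (Suc N)
  let ?S = "\<lambda>T. \<Sum>l<N. rsign T l *\<^sub>R a l"
  let ?s = "\<Sum>l<N. (norm (a l))\<^sup>2" and ?b = "norm (a N)"
  have "(\<Sum>T\<in>Pow {..<Suc N}. norm (\<Sum>l<Suc N. rsign T l *\<^sub>R a l) ^ 4)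
      = (\<Sum>T\<in>Pow {..<N}. norm (?S T + a N) ^ 4 + norm (?S T - a N) ^ 4)"
    unfolding sum_Pow_lessThan_Suc by (intro sum.cong refl) (simp only: Pow_iff rademacher_sum_Suc)
  also have "\<dots> \<le> (\<Sum>T\<in>Pow {..<N}. 2 * norm (?S T) ^ 4 + 12 * ?b\<^sup>2 * (norm (?S T))\<^sup>2 + 2 * ?b ^ 4)"
    by (intro sum_mono order_trans[OF parallelogram_norm_4]) simp
  also have "\<dots> = 2 * (\<Sum>T\<in>Pow {..<N}. norm (?S T) ^ 4)
      + 12 * ?b\<^sup>2 * (\<Sum>T\<in>Pow {..<N}. (norm (?S T))\<^sup>2) + 2 ^ N * (2 * ?b ^ 4)"
    by (simp add: sum.distrib card_Pow flip: sum_distrib_left)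
  also have "\<dots> \<le> 2 * (3 * 2 ^ N * ?s\<^sup>2) + 12 * ?b\<^sup>2 * (2 ^ N * ?s) + 2 ^ N * (2 * ?b ^ 4)"
    using Suc by (simp add: rademacher_second_moment)
  also have "\<dots> \<le> 3 * 2 ^ Suc N * (?s + ?b\<^sup>2)\<^sup>2"
    by (simp add: power2_sum algebra_simps)
  finally show ?case
    by simp
qed simp

text \<open>The elementary bound \<open>y^2 / c - y^4 / c^3 \<le> y\<close>, summed over all sign
  patterns, estimates the first moment from below by the second and fourth ones. Values in a real
  inner product space cover real and complex scalars together.\<close>

lemma Khinchine_L1:
  fixes a :: "nat \<Rightarrow> 'v::real_inner"
  shows "L2_set (\<lambda>l. norm (a l)) {..<N}
    \<le> (9/2) / 2 ^ N * (\<Sum>T\<in>Pow {..<N}. norm (\<Sum>l<N. rsign T l *\<^sub>R a l))"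
proof -
  define \<sigma> where "\<sigma> = L2_set (\<lambda>l. norm (a l)) {..<N}"
  have \<sigma>2: "(\<Sum>l<N. (norm (a l))\<^sup>2) = \<sigma>\<^sup>2"
    by (simp add: \<sigma>_def L2_set_def sum_nonneg)
  let ?Y = "\<lambda>T. norm (\<Sum>l<N. rsign T l *\<^sub>R a l)"
  have "\<sigma> \<ge> 0"
    by (simp add: \<sigma>_def)
  show ?thesis
  proof (cases "\<sigma> = 0")
    case True
    then show ?thesis
      unfolding \<sigma>_def by (simp add: sum_nonneg)
  next
    case False
    then have "\<sigma> > 0"
      using \<open>\<sigma> \<ge> 0\<close> by simp
    have *: "t\<^sup>2 - t ^ 4 \<le> t" if "0 \<le> t" for t :: real
    proof (cases "t \<le> 1")
      case True
      then show ?thesis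
        using that by (simp add: power2_eq_square mult_left_le add_increasing2 diff_le_eq)
    next
      case False
      then have "t\<^sup>2 \<le> t ^ 4"
        by (intro power_increasing) auto
      then show ?thesis
        using that by simp
    qed
    have key: "y\<^sup>2 / c - y ^ 4 / c ^ 3 \<le> y" if "0 \<le> y" "0 < c" for y c :: real
    proof -
      have "c * ((y / c)\<^sup>2 - (y / c) ^ 4) \<le> c * (y / c)"
        using that by (intro mult_left_mono *) auto
      moreover have "c * ((y / c)\<^sup>2 - (y / c) ^ 4) = y\<^sup>2 / c - y ^ 4 / c ^ 3"
        using that by (simp add: power_divide right_diff_distrib power2_eq_square power3_eq_cube power4_eq_xxxx)
      ultimately show ?thesis
        using that by simp
    qed
    \<comment> \<open>With \<open>c = r * \<sigma>\<close> the mean is at least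
      \<open>(1 / r - 3 / r^3) * \<sigma>\<close>. The coefficient is largest at
      \<open>r = 3\<close>, where it equals 2/9; hence the constant 9/2.\<close>
    have "(?Y T)\<^sup>2 / (3 * \<sigma>) - (?Y T) ^ 4 / (3 * \<sigma>) ^ 3 \<le> ?Y T" for T
      using \<open>\<sigma> > 0\<close> by (intro key) auto
    then have "(\<Sum>T\<in>Pow {..<N}. (?Y T)\<^sup>2 / (3 * \<sigma>) - (?Y T) ^ 4 / (3 * \<sigma>) ^ 3) \<le> (\<Sum>T\<in>Pow {..<N}. ?Y T)"
      by (intro sum_mono)
    moreover have "(\<Sum>T\<in>Pow {..<N}. (?Y T)\<^sup>2 / (3 * \<sigma>) - (?Y T) ^ 4 / (3 * \<sigma>) ^ 3)
        = 2 ^ N * \<sigma>\<^sup>2 / (3 * \<sigma>) - (\<Sum>T\<in>Pow {..<N}. ?Y T ^ 4) / (3 * \<sigma>) ^ 3"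
      unfolding sum_subtractf sum_divide_distrib[symmetric] rademacher_second_moment \<sigma>2 ..
    moreover have "(\<Sum>T\<in>Pow {..<N}. ?Y T ^ 4) / (3 * \<sigma>) ^ 3 \<le> 3 * 2 ^ N * (\<sigma>\<^sup>2)\<^sup>2 / (3 * \<sigma>) ^ 3"
      using rademacher_fourth_moment[where a = a and N = N] \<open>\<sigma> > 0\<close> unfolding \<sigma>2 by (intro divide_right_mono) auto
    moreover have "2 ^ N * \<sigma>\<^sup>2 / (3 * \<sigma>) - 3 * 2 ^ N * (\<sigma>\<^sup>2)\<^sup>2 / (3 * \<sigma>) ^ 3 = 2 ^ N * \<sigma> * (2/9)"
      using \<open>\<sigma> > 0\<close> by (simp add: field_simps power2_eq_square power3_eq_cube)
    ultimately have "2 ^ N * \<sigma> * (2/9) \<le> (\<Sum>T\<in>Pow {..<N}. ?Y T)"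
      by linarith
    then show ?thesis
      unfolding \<sigma>_def[symmetric] by (simp add: field_simps)
  qed
qed

section \<open>Multilinear forms on null sequences\<close>

lemma multilinear_formD:
  assumes "multilinear_form m A" "x \<in> tuples m" "j \<in> {1..m}" "y \<in> c0" "z \<in> c0"
  shows "A (x(j := (\<lambda>n. a * y n + b * z n))) = a * A (x(j := y)) + b * A (x(j := z))"
  using assms unfolding multilinear_form_def by blast

lemma multilinear_form_zero:
  assumes "multilinear_form m A" "x \<in> tuples m" "j \<in> {1..m}"
  shows "A (x(j := (\<lambda>n. 0))) = 0"
proof -
  show ?thesis
    using multilinear_formD[OF assms unit_vec_in_c0[of 0] unit_vec_in_c0[of 0], of 0 0] by simp
qed

lemma c0_eventually_zero:
  assumes "\<And>n. N \<le> n \<Longrightarrow> x n = 0"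
  shows "x \<in> c0"
  unfolding c0_def mem_Collect_eq
  by (rule tendsto_eventually) (auto simp: eventually_sequentially intro: assms)

lemma multilinear_form_sum:
  assumes "multilinear_form m A" "x \<in> tuples m" "j \<in> {1..m}"
  shows "A (x(j := (\<lambda>n. if n < N then c n else 0))) = (\<Sum>l<N. c l * A (x(j := unit_vec l)))"
proof (induction N)
  case 0
  then show ?case
    using multilinear_form_zero[OF assms] by (simp del: fun_upd_apply)
next
  case (Suc N)
  let ?y = "\<lambda>n. if n < N then c n else 0"
  have "?y \<in> c0"
    by (rule c0_eventually_zero[of N]) auto
  have "A (x(j := (\<lambda>n. 1 * ?y n + c N * unit_vec N n)))
      = 1 * A (x(j := ?y)) + c N * A (x(j := unit_vec N))"
    using \<open>?y \<in> c0\<close> unit_vec_in_c0 by (rule multilinear_formD[OF assms])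
  moreover have "(\<lambda>n. 1 * ?y n + c N * unit_vec N n) = (\<lambda>n. if n < Suc N then c n else 0)"
    by (auto simp: unit_vec_def fun_eq_iff less_Suc_eq)
  ultimately show ?case
    using Suc by (simp del: fun_upd_apply)
qed

lemma multilinear_form_scale:
  assumes "multilinear_form m A" "x \<in> tuples m" "j \<in> {1..m}"
  shows "A (x(j := (\<lambda>n. c * x j n))) = c * A x"
proof -
  have "x j \<in> c0"
    using assms by (auto simp: tuples_def)
  then show ?thesis
    using multilinear_formD[OF assms, of "x j" "x j" c 0] by simp
qed

lemma tuples_upd: "x \<in> tuples m \<Longrightarrow> j \<in> {1..m} \<Longrightarrow> y \<in> c0 \<Longrightarrow> x(j := y) \<in> tuples m"
  unfolding tuples_def by (auto simp: PiE_iff extensional_def)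

text \<open>One argument is scaled at a time. With \<open>J = {1..m}\<close> this transfers a bound
  near the origin to the whole unit ball.\<close>

lemma multilinear_form_scale_all:
  assumes A: "multilinear_form m A" and x: "x \<in> tuples m" and J: "J \<subseteq> {1..m}"
  shows "A (\<lambda>j. if j \<in> J then (\<lambda>n. c * x j n) else x j) = c ^ card J * A x"
    and "(\<lambda>j. if j \<in> J then (\<lambda>n. c * x j n) else x j) \<in> tuples m"
proof -
  have "finite J"
    using J finite_subset by blast
  then have "A (\<lambda>j. if j \<in> J then (\<lambda>n. c * x j n) else x j) = c ^ card J * A x \<and>
      (\<lambda>j. if j \<in> J then (\<lambda>n. c * x j n) else x j) \<in> tuples m"
    using J
  proof (induction J rule: finite_induct)
    case (insert k J)
    let ?x = "\<lambda>j. if j \<in> J then (\<lambda>n. c * x j n) else x j"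
    have *: "(\<lambda>j. if j \<in> insert k J then (\<lambda>n. c * x j n) else x j) = ?x(k := (\<lambda>n. c * ?x k n))"
      using insert.hyps by auto
    have k: "k \<in> {1..m}" and IH: "A ?x = c ^ card J * A x" "?x \<in> tuples m"
      using insert by auto
    have "x k \<in> c0"
      using x k by (auto simp: tuples_def)
    then show ?case
      unfolding * using IH insert.hyps multilinear_form_scale[OF A IH(2) k, of c]
      by (auto intro!: tuples_upd[OF IH(2) k] c0_scale)
  qed (use x in auto)
  then show "A (\<lambda>j. if j \<in> J then (\<lambda>n. c * x j n) else x j) = c ^ card J * A x"
    and "(\<lambda>j. if j \<in> J then (\<lambda>n. c * x j n) else x j) \<in> tuples m"
    by auto
qed

section \<open>Boundedness of continuous forms on the unit ball\<close>

lemma sup_norm_le: "(\<And>n. norm (x n) \<le> b) \<Longrightarrow> sup_norm x \<le> b"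
  unfolding sup_norm_def by (rule cSUP_least) auto

lemma mball_c0_metric:
  "0 < r \<Longrightarrow> y \<in> c0 \<Longrightarrow> sup_norm y < r
    \<Longrightarrow> y \<in> Metric_space.mball c0 (mdist c0_metric) (\<lambda>n. 0) r"
proof -
  assume *: "0 < r" "y \<in> c0" "sup_norm y < r"
  have "(\<lambda>n. 0) \<in> (c0 :: (nat \<Rightarrow> 'a) set)"
    by (simp add: c0_def)
  moreover have "c0_dist (\<lambda>n. 0) y = sup_norm y"
    by (simp add: c0_dist_def sup_norm_def)
  ultimately show ?thesis
    using * Metric_space.in_mball[OF Metric_space_mspace_mdist[of "c0_metric :: (nat \<Rightarrow> 'a) metric"]]
      mdist_c0_metric[of "\<lambda>n. 0 :: 'a" y]
    by simp
qed

text \<open>Continuity at the zero tuple gives a product of balls on which \<open>A\<close> has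
  modulus below 1; scaling all arguments by a small \<open>\<delta>\<close> moves the unit ball into
  it, at the cost of the factor \<open>\<delta> ^ m\<close>.\<close>

lemma continuous_multilinear_form_bdd:
  assumes "continuous_multilinear_form m A" "1 \<le> m"
  obtains B where "\<And>x. x \<in> tuples m \<Longrightarrow> (\<And>j. j \<in> {1..m} \<Longrightarrow> sup_norm (x j) \<le> 1) \<Longrightarrow> norm (A x) \<le> B"
proof -
  let ?X = "product_topology (\<lambda>_. mtopology_of (c0_metric :: (nat \<Rightarrow> 'a) metric)) {1..m}"
  have A: "multilinear_form m A" and cont: "continuous_map ?X euclidean A"
    using assms by (auto simp: continuous_multilinear_form_def)
  define z :: "nat \<Rightarrow> nat \<Rightarrow> 'a" where "z = (\<lambda>j\<in>{1..m}. \<lambda>n. 0)"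
  have z0: "(\<lambda>n. 0) \<in> (c0 :: (nat \<Rightarrow> 'a) set)"
    by (simp add: c0_def)
  then have z: "z \<in> tuples m"
    by (auto simp: z_def tuples_def)
  have "z(1 := (\<lambda>n. 0)) = z"
    using assms(2) by (auto simp: z_def)
  then have "A z = 0"
    using multilinear_form_zero[OF A z, of 1] assms(2) by simp
  have top: "topspace ?X = tuples m"
    by (simp add: tuples_def)
  have op: "openin ?X {x \<in> topspace ?X. A x \<in> ball 0 1}"
    by (rule openin_continuous_map_preimage[OF cont]) (simp add: open_openin[symmetric])
  have zin: "z \<in> {x \<in> topspace ?X. A x \<in> ball 0 1}"
    using z \<open>A z = 0\<close> unfolding top by simp
  obtain U where U: "\<And>j. j \<in> {1..m} \<Longrightarrow> openin (mtopology_of c0_metric) (U j)"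
      "z \<in> Pi\<^sub>E {1..m} U" "Pi\<^sub>E {1..m} U \<subseteq> {x \<in> topspace ?X. A x \<in> ball 0 1}"
    using op[unfolded openin_product_topology_alt, rule_format, OF zin] by blast
  interpret C: Metric_space c0 "mdist (c0_metric :: (nat \<Rightarrow> 'a) metric)"
    using Metric_space_mspace_mdist[of "c0_metric :: (nat \<Rightarrow> 'a) metric"] by simp
  have "\<exists>r>0. C.mball (\<lambda>n. 0) r \<subseteq> U j" if j: "j \<in> {1..m}" for j
  proof -
    have "(\<lambda>n. 0) \<in> U j"
      using PiE_mem[OF U(2) j] j by (simp add: z_def)
    moreover have "openin C.mtopology (U j)"
      using U(1)[OF j] by (simp add: mtopology_of_def)
    ultimately show ?thesis
      unfolding C.openin_mtopology by blast
  qed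
  then obtain r where r: "\<And>j. j \<in> {1..m} \<Longrightarrow> 0 < r j"
      "\<And>j. j \<in> {1..m} \<Longrightarrow> C.mball (\<lambda>n. 0) (r j) \<subseteq> U j"
    by metis
  \<comment> \<open>Half of the smallest radius lies strictly below every \<open>r j\<close>, as the
    open balls require.\<close>
  define \<delta> where "\<delta> = Min (r ` {1..m}) / 2"
  have \<delta>: "0 < \<delta>"
    using r assms(2) by (auto simp: \<delta>_def)
  have \<delta>r: "\<delta> < r j" if "j \<in> {1..m}" for j
  proof -
    have "Min (r ` {1..m}) \<le> r j"
      using that by auto
    then show ?thesis
      using r(1)[OF that] \<delta> by (simp add: \<delta>_def)
  qed
  show thesis
  proof
    fix x :: "nat \<Rightarrow> nat \<Rightarrow> 'a"
    assume x: "x \<in> tuples m" and x1: "\<And>j. j \<in> {1..m} \<Longrightarrow> sup_norm (x j) \<le> 1"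
    let ?y = "\<lambda>j. if j \<in> {1..m} then (\<lambda>n. of_real \<delta> * x j n) else x j"
    have y: "A ?y = of_real \<delta> ^ m * A x" "?y \<in> tuples m"
      using multilinear_form_scale_all[OF A x, of "{1..m}" "of_real \<delta>"] by auto
    have "?y j \<in> U j" if j: "j \<in> {1..m}" for j
    proof -
      have "x j \<in> c0"
        using x j by (auto simp: tuples_def)
      moreover have "sup_norm (\<lambda>n. of_real \<delta> * x j n) \<le> \<delta>"
      proof (rule sup_norm_le)
        fix n
        have "norm (x j n) \<le> 1"
          using norm_le_sup_norm[OF \<open>x j \<in> c0\<close>, of n] x1[OF j] by linarith
        then show "norm (of_real \<delta> * x j n) \<le> \<delta>"
          using \<delta> by (simp add: norm_mult mult_left_le)
      qed
      ultimately have "(\<lambda>n. of_real \<delta> * x j n) \<in> C.mball (\<lambda>n. 0) (r j)"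
        using r(1)[OF j] \<delta>r[OF j] by (intro mball_c0_metric c0_scale) auto
      then show ?thesis
        using r(2)[OF j] j by auto
    qed
    moreover have "?y \<in> extensional {1..m}"
      using x by (auto simp: tuples_def PiE_iff extensional_def)
    ultimately have "?y \<in> Pi\<^sub>E {1..m} U"
      unfolding PiE_iff by blast
    then have "norm (A ?y) < 1"
      using U(3) by auto
    then have "\<delta> ^ m * norm (A x) \<le> 1"
      using y(1) \<delta> by (simp add: norm_mult norm_power)
    then show "norm (A x) \<le> 1 / \<delta> ^ m"
      using \<delta> by (simp add: field_simps)
  qed
qed

text \<open>A real supremum is known to dominate its members once the set is bounded above;
  \<open>continuous_multilinear_form_bdd\<close> supplies the bound.\<close>

lemma norm_le_form_norm:
  assumes "continuous_multilinear_form m A" "1 \<le> m"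
    and "x \<in> tuples m" "\<And>j. j \<in> {1..m} \<Longrightarrow> sup_norm (x j) \<le> 1"
  shows "norm (A x) \<le> form_norm m A"
proof -
  obtain B where "\<And>x. x \<in> tuples m \<Longrightarrow> (\<And>j. j \<in> {1..m} \<Longrightarrow> sup_norm (x j) \<le> 1) \<Longrightarrow> norm (A x) \<le> B"
    using continuous_multilinear_form_bdd[OF assms(1,2)] by blast
  then have "bdd_above ((\<lambda>x. norm (A x)) ` {x \<in> tuples m. \<forall>j\<in>{1..m}. sup_norm (x j) \<le> 1})"
    unfolding bdd_above_def by (intro exI[of _ B]) auto
  then show ?thesis
    unfolding form_norm_def using assms by (intro cSUP_upper) auto
qed

text \<open>The arguments outside \<open>J\<close> are frozen at \<open>x\<close>. Khinchine's
  inequality removes positions from \<open>J\<close> one by one and freezes them at sign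
  vectors.\<close>

definition coeff_norm ::
  "((nat \<Rightarrow> nat \<Rightarrow> 'k::real_normed_field) \<Rightarrow> 'k) \<Rightarrow> nat set \<Rightarrow> (nat \<Rightarrow> nat \<Rightarrow> 'k) \<Rightarrow> (nat \<Rightarrow> nat) \<Rightarrow> real"
  where "coeff_norm A J x i = norm (A (\<lambda>j. if j \<in> J then unit_vec (i j) else x j))"

lemma coeff_norm_nonneg [simp]: "0 \<le> coeff_norm A J x i"
  by (simp add: coeff_norm_def)

lemma tuples_unit_vec:
  assumes "x \<in> tuples m" "J \<subseteq> {1..m}"
  shows "(\<lambda>j. if j \<in> J then unit_vec (i j) else x j) \<in> tuples m"
  using assms unit_vec_in_c0 by (auto simp: tuples_def PiE_iff extensional_def)

definition sign_vec :: "nat \<Rightarrow> nat set \<Rightarrow> nat \<Rightarrow> 'k::real_normed_field"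
  where "sign_vec N T = (\<lambda>l. if l < N then of_real (rsign T l) else 0)"

lemma sign_vec_in_c0: "sign_vec N T \<in> c0"
  by (rule c0_eventually_zero[of N]) (simp add: sign_vec_def)

lemma sup_norm_sign_vec: "sup_norm (sign_vec N T) \<le> 1"
  by (rule sup_norm_le) (simp add: sign_vec_def rsign_def)

text \<open>By linearity in position \<open>j\<close>, a signed sum of coefficients is a value of
  \<open>A\<close> at a sign vector. An l2 sum is thus traded for an average over frozen arguments
  from the unit ball.\<close>

lemma coeff_norm_Khinchine:
  fixes A :: "(nat \<Rightarrow> nat \<Rightarrow> 'k::{real_normed_field,real_inner}) \<Rightarrow> 'k"
  assumes A: "multilinear_form m A" and x: "x \<in> tuples m"
    and J: "insert j J \<subseteq> {1..m}" "j \<notin> J"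
  shows "lp_norm N 2 (\<lambda>n. coeff_norm A (insert j J) x (i(j := n)))
    \<le> (\<Sum>T\<in>Pow {..<N}. (9/2) / 2 ^ N * coeff_norm A J (x(j := sign_vec N T)) i)"
proof -
  let ?y = "\<lambda>j. if j \<in> J then unit_vec (i j) else x j"
  have y: "?y \<in> tuples m" and j: "j \<in> {1..m}"
    using tuples_unit_vec[OF x, of J i] J by auto
  have 1: "coeff_norm A (insert j J) x (i(j := n)) = norm (A (?y(j := unit_vec n)))" for n
    unfolding coeff_norm_def using J by (intro arg_cong[of _ _ norm] arg_cong[of _ _ A]) auto
  have 2: "coeff_norm A J (x(j := sign_vec N T)) i
      = norm (\<Sum>l<N. rsign T l *\<^sub>R A (?y(j := unit_vec l)))" for T
  proof -
    have "coeff_norm A J (x(j := sign_vec N T)) i = norm (A (?y(j := sign_vec N T)))"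
      unfolding coeff_norm_def using J by (intro arg_cong[of _ _ norm] arg_cong[of _ _ A]) auto
    also have "A (?y(j := sign_vec N T)) = (\<Sum>l<N. of_real (rsign T l) * A (?y(j := unit_vec l)))"
      unfolding sign_vec_def by (rule multilinear_form_sum[OF A y j])
    finally show ?thesis
      by (simp add: scaleR_conv_of_real del: fun_upd_apply)
  qed
  show ?thesis
    unfolding 1 2 using Khinchine_L1[of "\<lambda>l. A (?y(j := unit_vec l))" N]
    by (simp add: lp_norm_two sum_distrib_left del: fun_upd_apply)
qed

text \<open>The coefficients are aligned by unimodular scalars.\<close>

lemma sum_coeff_norm_le_form_norm:
  assumes A: "continuous_multilinear_form m A" "1 \<le> m" and x: "x \<in> tuples m"
    and x1: "\<And>j. j \<in> {1..m} \<Longrightarrow> sup_norm (x j) \<le> 1" and k: "k \<in> {1..m}"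
  shows "(\<Sum>n<N. coeff_norm A {k} x (i(k := n))) \<le> form_norm m A"
proof -
  define u where "u n = (if A (x(k := unit_vec n)) = 0 then 0
    else of_real (norm (A (x(k := unit_vec n)))) / A (x(k := unit_vec n)))" for n
  let ?u = "\<lambda>n. if n < N then u n else 0"
  have u: "?u \<in> c0"
    by (rule c0_eventually_zero[of N]) auto
  have u1: "sup_norm ?u \<le> 1"
    by (rule sup_norm_le) (auto simp: u_def norm_divide)
  have 1: "coeff_norm A {k} x (i(k := n)) = norm (A (x(k := unit_vec n)))" for n
    unfolding coeff_norm_def by (intro arg_cong[of _ _ norm] arg_cong[of _ _ A]) auto
  have "A (x(k := ?u)) = (\<Sum>n<N. u n * A (x(k := unit_vec n)))"
    using A by (intro multilinear_form_sum[OF _ x k]) (simp add: continuous_multilinear_form_def)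
  also have "\<dots> = of_real (\<Sum>n<N. norm (A (x(k := unit_vec n))))"
    unfolding of_real_sum by (intro sum.cong) (auto simp: u_def)
  finally have "norm (A (x(k := ?u))) = (\<Sum>n<N. norm (A (x(k := unit_vec n))))"
    by (simp add: sum_nonneg del: of_real_sum fun_upd_apply)
  moreover have "norm (A (x(k := ?u))) \<le> form_norm m A"
    using x x1 u u1 k by (intro norm_le_form_norm[OF A] tuples_upd) auto
  ultimately show ?thesis
    by (simp add: 1)
qed

text \<open>Induction from the innermost variable: Khinchine's inequality replaces its l2 sum by an
  average, which the triangle inequality moves outside the remaining norms. The tuple
  \<open>x\<close> is generalised because the induction hypothesis is applied with a sign vector
  inserted; the base case is the l1 estimate in position \<open>k\<close>.\<close>

lemma mixed_norm_one_two:
  fixes A :: "(nat \<Rightarrow> nat \<Rightarrow> 'k::{real_normed_field,real_inner}) \<Rightarrow> 'k"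
  assumes A: "continuous_multilinear_form m A" "1 \<le> m"
    and p: "p k = 1" "\<And>j. j \<in> set js \<Longrightarrow> p j = 2"
    and js: "distinct (k # js)" "set (k # js) \<subseteq> {1..m}"
    and x: "x \<in> tuples m" "\<And>j. j \<in> {1..m} \<Longrightarrow> sup_norm (x j) \<le> 1"
  shows "mixed_norm N p (k # js) (coeff_norm A (set (k # js)) x) i \<le> (9/2) ^ length js * form_norm m A"
  using p js x
proof (induction js arbitrary: x rule: rev_induct)
  case Nil
  then show ?case
    using sum_coeff_norm_le_form_norm[OF A, where x = x and k = k and N = N and i = i] by (simp add: lp_norm_one)
next
  case (snoc j js)
  let ?J = "set (k # js)" and ?c = "(9/2) / 2 ^ N :: real" and ?B = "(9/2) ^ length js * form_norm m A"
  have mult: "multilinear_form m A"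
    using A by (simp add: continuous_multilinear_form_def)
  have j: "j \<notin> ?J" "insert j ?J \<subseteq> {1..m}" "j \<in> {1..m}" "p j = 2"
    using snoc.prems by auto
  have set_eq: "set (k # js @ [j]) = insert j ?J"
    by auto
  have pos: "0 < p l" and one_two: "p l = 1 \<or> p l = 2" if "l \<in> set (k # js)" for l
    using that snoc.prems by force+
  have "mixed_norm N p (k # js @ [j]) (coeff_norm A (set (k # js @ [j])) x) i
      = mixed_norm N p (k # js) (\<lambda>i. lp_norm N 2 (\<lambda>n. coeff_norm A (insert j ?J) x (i(j := n)))) i"
  proof -
    have "mixed_norm N p [j] (coeff_norm A (insert j ?J) x)
        = (\<lambda>i. lp_norm N 2 (\<lambda>n. coeff_norm A (insert j ?J) x (i(j := n))))"
      using j by (simp add: fun_eq_iff)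
    then show ?thesis
      unfolding set_eq unfolding append_Cons[symmetric] by (simp only: mixed_norm_append)
  qed
  also have "\<dots> \<le> mixed_norm N p (k # js)
      (\<lambda>i. \<Sum>T\<in>Pow {..<N}. ?c * coeff_norm A ?J (x(j := sign_vec N T)) i) i"
    using pos j snoc.prems by (intro mixed_norm_mono coeff_norm_Khinchine[OF mult]) auto
  also have "\<dots> \<le> (\<Sum>T\<in>Pow {..<N}. mixed_norm N p (k # js)
      (\<lambda>i. ?c * coeff_norm A ?J (x(j := sign_vec N T)) i) i)"
    using one_two by (intro mixed_norm_sum_le) auto
  also have "\<dots> = (\<Sum>T\<in>Pow {..<N}. ?c * mixed_norm N p (k # js)
      (coeff_norm A ?J (x(j := sign_vec N T))) i)"
    using pos by (intro sum.cong refl mixed_norm_scale) auto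
  also have "\<dots> \<le> (\<Sum>T\<in>Pow {..<N}. ?c * ?B)"
  proof (intro sum_mono mult_left_mono)
    fix T
    show "mixed_norm N p (k # js) (coeff_norm A ?J (x(j := sign_vec N T))) i \<le> ?B"
      using snoc.prems j by (intro snoc.IH tuples_upd sign_vec_in_c0) (auto simp: sup_norm_sign_vec)
  qed simp
  \<comment> \<open>There are \<open>2 ^ N\<close> sign patterns, so the weights \<open>?c\<close>
    add up to 9/2, whatever \<open>N\<close> is.\<close>
  also have "\<dots> = (9/2) ^ length (js @ [j]) * form_norm m A"
    by (simp add: card_Pow)
  finally show ?case .
qed

section \<open>The mixed inequality\<close>

lemma ennpow_ennreal: "0 \<le> x \<Longrightarrow> ennpow (ennreal x) p = ennreal (x powr p)"
  by (simp add: ennpow_def)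

lemma ennpow_mono: "0 \<le> p \<Longrightarrow> x \<le> y \<Longrightarrow> ennpow x p \<le> ennpow y p"
  by (cases x; cases y) (auto simp: ennpow_def top_unique intro!: ennreal_leI powr_mono2)

text \<open>If the supremum of the powers is a finite \<open>b\<close>, then every
  \<open>g n\<close> is at most \<open>b powr (1 / r)\<close>, and monotonicity of the power
  finishes; an infinite supremum is trivial.\<close>

lemma ennpow_SUP_le:
  assumes "0 < r" "\<And>n. 0 \<le> g n"
  shows "ennpow (SUP n. ennreal (g n)) r \<le> (SUP n. ennreal (g n powr r))"
proof (cases "SUP n. ennreal (g n powr r)")
  case (real b)
  have "ennreal (g n) \<le> ennreal (b powr (1 / r))" for n
  proof -
    have "ennreal (g n powr r) \<le> ennreal b"
      unfolding real(2)[symmetric] by (rule SUP_upper) simp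
    then have "(g n powr r) powr (1 / r) \<le> b powr (1 / r)"
      using real(1) assms by (intro powr_mono2) auto
    then show ?thesis
      using assms by (simp add: powr_powr ennreal_leI)
  qed
  then have "ennpow (SUP n. ennreal (g n)) r \<le> ennpow (ennreal (b powr (1 / r))) r"
    using assms by (intro ennpow_mono SUP_least) auto
  also have "\<dots> = ennreal b"
    using real(1) assms by (simp add: ennpow_ennreal powr_powr)
  finally show ?thesis
    by (simp add: real(2))
next
  case top
  show ?thesis
    unfolding top by simp
qed

text \<open>Downward induction from \<open>k = m\<close>; monotone convergence exchanges the sum
  over \<open>n\<close> with the supremum over \<open>N\<close>. The power \<open>q k\<close> on the
  right appears because \<open>nested_sum\<close> takes no outermost root.\<close>

lemma nested_sum_le_SUP:
  assumes "k \<le> m" "1 \<le> k" "\<And>j. j \<in> {1..m} \<Longrightarrow> 0 < q j" "\<And>i. 0 \<le> a i"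
  shows "nested_sum m q a k i \<le> (SUP N. ennreal (mixed_norm N q [k..<Suc m] a i powr q k))"
  using assms(1,2)
proof (induction k arbitrary: i rule: inc_induct)
  case base
  have "nested_sum m q a m i = (\<Sum>n. ennreal (a (i(m := n)) powr q m))"
    using assms by (subst nested_sum.simps) (simp add: ennpow_ennreal)
  also have "\<dots> = (SUP N. ennreal (\<Sum>n<N. a (i(m := n)) powr q m))"
    by (simp add: suminf_eq_SUP del: sum_ennreal flip: sum_ennreal)
  finally show ?case
    using assms(3)[of m] base by (simp add: lp_norm_powr)
next
  case (step k)
  let ?M = "\<lambda>N n. mixed_norm N q [Suc k..<Suc m] a (i(k := n))"
  have q: "0 < q k" "0 < q (Suc k)"
    using assms(3) step by auto
  have M: "0 \<le> ?M N n" for N n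
    using assms(4) by (rule mixed_norm_nonneg)
  have mono: "?M N n \<le> ?M N' n" if "N \<le> N'" for N N' n
    using assms step.prems step.hyps that by (intro mixed_norm_mono_length) auto
  have list: "[k..<Suc m] = k # [Suc k..<Suc m]"
    using step.hyps by (simp add: upt_conv_Cons)
  have "nested_sum m q a k i = (\<Sum>n. ennpow (nested_sum m q a (Suc k) (i(k := n))) (q k / q (Suc k)))"
    using step.hyps by (subst nested_sum.simps) simp
  also have "\<dots> \<le> (\<Sum>n. SUP N. ennreal (?M N n powr q k))"
  proof (intro suminf_le summableI)
    fix n
    have "ennpow (nested_sum m q a (Suc k) (i(k := n))) (q k / q (Suc k))
        \<le> ennpow (SUP N. ennreal (?M N n powr q (Suc k))) (q k / q (Suc k))"
      using step q by (intro ennpow_mono step.IH) auto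
    also have "\<dots> \<le> (SUP N. ennreal ((?M N n powr q (Suc k)) powr (q k / q (Suc k))))"
      using q by (intro ennpow_SUP_le) auto
    finally show "ennpow (nested_sum m q a (Suc k) (i(k := n))) (q k / q (Suc k))
        \<le> (SUP N. ennreal (?M N n powr q k))"
      using q by (simp add: powr_powr)
  qed
  also have "\<dots> = (SUP N. \<Sum>n. ennreal (?M N n powr q k))"
    using mono M q by (intro ennreal_suminf_SUP_eq) (auto simp: incseq_def intro!: ennreal_leI powr_mono2)
  also have "\<dots> \<le> (SUP N. ennreal (mixed_norm N q [k..<Suc m] a i powr q k))"
  proof (rule SUP_least)
    fix N
    show "(\<Sum>n. ennreal (?M N n powr q k)) \<le> (SUP N. ennreal (mixed_norm N q [k..<Suc m] a i powr q k))"
      unfolding suminf_eq_SUP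
    proof (rule SUP_least)
      fix L
      \<comment> \<open>The truncation lengths \<open>N\<close> of the inner variables and
        \<open>L\<close> of the outer one are replaced by a common length, which only enlarges the
        norm.\<close>
      let ?R = "max N L"
      have "(\<Sum>n<L. ennreal (?M N n powr q k)) \<le> (\<Sum>n<?R. ennreal (?M ?R n powr q k))"
        using mono[of N ?R] M q
        by (intro order_trans[OF sum_mono sum_mono2]) (auto intro!: ennreal_leI powr_mono2)
      also have "\<dots> = ennreal (mixed_norm ?R q [k..<Suc m] a i powr q k)"
        unfolding list mixed_norm.simps using q by (simp add: lp_norm_powr del: upt_Suc)
      also have "\<dots> \<le> (SUP N. ennreal (mixed_norm N q [k..<Suc m] a i powr q k))"
        by (rule SUP_upper) simp
      finally show "(\<Sum>n<L. ennreal (?M N n powr q k))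
          \<le> (SUP N. ennreal (mixed_norm N q [k..<Suc m] a i powr q k))" .
    qed
  qed
  finally show ?case .
qed

text \<open>For \<open>t\<close> in \<open>{1..m}\<close> the exponent 1 is moved to the front and
  \<open>mixed_norm_one_two\<close> applies. Any other \<open>t\<close> makes all exponents 2, which
  reduces to \<open>t = 1\<close> since the l2 norm in the first variable is at most the l1
  norm.\<close>

lemma mixed_norm_endpoint:
  fixes A :: "(nat \<Rightarrow> nat \<Rightarrow> 'k::{real_normed_field,real_inner}) \<Rightarrow> 'k"
  assumes A: "continuous_multilinear_form m A" "1 \<le> m"
    and x: "x \<in> tuples m" "\<And>j. j \<in> {1..m} \<Longrightarrow> sup_norm (x j) \<le> 1"
  shows "mixed_norm N (\<lambda>j. if j = t then 1 else 2) [1..<Suc m] (coeff_norm A {1..m} x) i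
    \<le> (9/2) ^ (m - 1) * form_norm m A"
proof -
  let ?p = "\<lambda>t j. if j = t then 1 else 2 :: real"
  let ?F = "coeff_norm A {1..m} x"
  have main: "mixed_norm N (?p k) [1..<Suc m] ?F i \<le> (9/2) ^ (m - 1) * form_norm m A"
    if k: "k \<in> {1..m}" for k
  proof -
    let ?js = "[1..<k] @ [Suc k..<Suc m]"
    have "[1..<Suc m] = [1..<k] @ k # [Suc k..<Suc m]"
      using k upt_add_eq_append[of 1 k "Suc m - k"] by (simp add: upt_conv_Cons)
    then have "mixed_norm N (?p k) [1..<Suc m] ?F i = mixed_norm N (?p k) ([1..<k] @ k # [Suc k..<Suc m]) ?F i"
      by simp
    also have "\<dots> \<le> mixed_norm N (?p k) (k # ?js) ?F i"
      by (rule mixed_norm_move_one) auto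
    also have "\<dots> = mixed_norm N (?p k) (k # ?js) (coeff_norm A (set (k # ?js)) x) i"
      using k by (intro arg_cong[of "{1..m}" _ "\<lambda>J. mixed_norm N (?p k) (k # ?js) (coeff_norm A J x) i"]) auto
    also have "\<dots> \<le> (9/2) ^ length ?js * form_norm m A"
      using k by (intro mixed_norm_one_two[OF A _ _ _ _ x]) auto
    also have "length ?js = m - 1"
      using k by auto
    finally show ?thesis .
  qed
  show ?thesis
  proof (cases "t \<in> {1..m}")
    case True
    then show ?thesis
      by (rule main)
  next
    case False
    have list: "[1..<Suc m] = 1 # [2..<Suc m]"
      using A(2) by (simp add: upt_conv_Cons numeral_2_eq_2)
    have "mixed_norm N (?p t) [2..<Suc m] ?F i = mixed_norm N (?p 1) [2..<Suc m] ?F i" for i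
      using False by (intro mixed_norm_cong) auto
    then have "mixed_norm N (?p t) [1..<Suc m] ?F i \<le> mixed_norm N (?p 1) [1..<Suc m] ?F i"
      using False A(2) unfolding list
      by (simp add: lp_norm_one lp_norm_two mixed_norm_nonneg L2_set_le_sum del: upt_Suc)
    also have "\<dots> \<le> (9/2) ^ (m - 1) * form_norm m A"
      using A(2) by (intro main) simp
    finally show ?thesis .
  qed
qed

text \<open>All endpoints share one bound, so their weighted geometric mean obeys it as well,
  uniformly in the truncation length.\<close>

lemma mixed_sum_le:
  fixes A :: "(nat \<Rightarrow> nat \<Rightarrow> 'k::{real_normed_field,real_inner}) \<Rightarrow> 'k"
  assumes A: "continuous_multilinear_form m A" "1 \<le> m"
    and q: "\<And>j. j \<in> {1..m} \<Longrightarrow> q j \<in> {1..2}" "(\<Sum>j=1..m. 1 / q j) \<le> (real m + 1) / 2"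
  shows "mixed_sum m q A \<le> ennreal ((9/2) ^ (m - 1) * form_norm m A)"
proof -
  \<comment> \<open>The positions in \<open>{1..m}\<close> are overwritten by unit vectors; outside,
    \<open>x\<close> takes the value \<open>undefined\<close> prescribed for extensional
    tuples.\<close>
  define x :: "nat \<Rightarrow> nat \<Rightarrow> 'k" where "x = (\<lambda>j\<in>{1..m}. \<lambda>n. 0)"
  let ?F = "coeff_norm A {1..m} x" and ?B = "(9/2) ^ (m - 1) * form_norm m A"
  let ?p = "\<lambda>t j. if j = t then 1 else 2 :: real"
  \<comment> \<open>Index 0 stands for the point with all exponents 2 and receives the remaining
    weight; this weight is nonnegative by condition (2).\<close>
  define \<theta> where "\<theta> t = (if t = 0 then 1 - (\<Sum>j=1..m. 2 / q j - 1) else 2 / q t - 1)" for t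
  have qpos: "0 < q j" if "j \<in> {1..m}" for j
    using q(1)[OF that] by auto
  have x: "x \<in> tuples m" "\<And>j. j \<in> {1..m} \<Longrightarrow> sup_norm (x j) \<le> 1"
    by (auto simp: x_def tuples_def c0_def sup_norm_def)
  have F: "(\<lambda>i. norm (A (\<lambda>j\<in>{1..m}. unit_vec (i j)))) = ?F"
    by (auto simp: coeff_norm_def x_def fun_eq_iff intro!: arg_cong[of _ _ norm] arg_cong[of _ _ A])
  have B: "0 \<le> ?B"
    using order_trans[OF mixed_norm_nonneg mixed_norm_endpoint[OF A x]] by simp
  have split0: "(\<Sum>t\<in>{0..m}. f t) = f 0 + (\<Sum>t=1..m. f t)" for f :: "nat \<Rightarrow> real"
    by (simp add: sum.atLeast_Suc_atMost)
  have \<theta>1: "sum \<theta> {0..m} = 1"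
    unfolding split0 by (simp add: \<theta>_def)
  have \<theta>0: "0 \<le> \<theta> t" if t: "t \<in> {0..m}" for t
  proof (cases "t = 0")
    case True
    have "(\<Sum>j=1..m. 2 / q j - 1) = 2 * (\<Sum>j=1..m. 1 / q j) - m"
      by (simp add: sum_subtractf sum_distrib_left)
    then show ?thesis
      using True q(2) by (simp add: \<theta>_def)
  next
    case False
    then show ?thesis
      using q(1)[of t] t by (auto simp: \<theta>_def field_simps)
  qed
  have \<theta>q: "1 / q j = (\<Sum>t\<in>{0..m}. \<theta> t / ?p t j)" if j: "j \<in> {1..m}" for j
  proof -
    have "(\<Sum>t\<in>{0..m}. \<theta> t / ?p t j) = (\<Sum>t\<in>{0..m}. \<theta> t / 2 + (if t = j then \<theta> t / 2 else 0))"
      by (intro sum.cong) auto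
    also have "\<dots> = sum \<theta> {0..m} / 2 + \<theta> j / 2"
      using j by (simp add: sum.distrib sum_divide_distrib)
    also have "\<theta> j / 2 = 1 / q j - 1 / 2"
      using j by (simp add: \<theta>_def diff_divide_distrib)
    finally show ?thesis
      using \<theta>1 by simp
  qed
  have le: "mixed_norm N q [1..<Suc m] ?F i \<le> ?B" for N i
  proof -
    have "mixed_norm N q [1..<Suc m] ?F i
        \<le> (\<Prod>t\<in>{0..m}. mixed_norm N (?p t) [1..<Suc m] ?F i powr \<theta> t)"
      using qpos \<theta>q \<theta>0 \<theta>1 by (intro mixed_norm_interpolate) auto
    also have "\<dots> \<le> (\<Prod>t\<in>{0..m}. ?B powr \<theta> t)"
      using \<theta>0 by (intro prod_mono conjI powr_mono2 mixed_norm_endpoint[OF A x] mixed_norm_nonneg) auto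
    also have "\<dots> = ?B"
      using B \<theta>1 by (intro prod_powr_weights) auto
    finally show ?thesis .
  qed
  have "mixed_sum m q A \<le> ennpow (SUP N. ennreal (mixed_norm N q [1..<Suc m] ?F (\<lambda>_. 0) powr q 1)) (1 / q 1)"
    unfolding mixed_sum_def F using qpos A(2)
    by (intro ennpow_mono nested_sum_le_SUP) (auto simp: less_imp_le)
  also have "\<dots> \<le> ennpow (ennreal (?B powr q 1)) (1 / q 1)"
    using qpos[of 1] A(2) le
    by (intro ennpow_mono SUP_least ennreal_leI powr_mono2 mixed_norm_nonneg) (auto simp: less_imp_le)
  also have "\<dots> = ennreal ?B"
    using qpos[of 1] A(2) B by (simp add: ennpow_ennreal powr_powr)
  finally show ?thesis .
qed

section \<open>Extremal forms from Sylvester matrices\<close>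

text \<open>The Sylvester-Hadamard matrix of order \<open>2 ^ d\<close>: doubling places four
  copies, the lower right one negated, and \<open>mod 2 ^ d\<close> gives the position inside a
  block.\<close>

fun sylvester :: "nat \<Rightarrow> nat \<Rightarrow> nat \<Rightarrow> real"
  where
    "sylvester 0 i j = 1"
  | "sylvester (Suc d) i j =
      sylvester d (i mod 2 ^ d) (j mod 2 ^ d) * (if 2 ^ d \<le> i \<and> 2 ^ d \<le> j then -1 else 1)"

lemma abs_sylvester [simp]: "\<bar>sylvester d i j\<bar> = 1"
  by (induction d arbitrary: i j) (auto simp: abs_mult)

lemma sum_lessThan_add:
  fixes f :: "nat \<Rightarrow> 'b::comm_monoid_add"
  shows "(\<Sum>i<n + k. f i) = (\<Sum>i<n. f i) + (\<Sum>i<k. f (n + i))"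
  by (induction k) (auto simp: add.assoc)

text \<open>The halves of \<open>z\<close> have transforms \<open>u\<close> and \<open>v\<close>,
  and the doubled matrix returns \<open>u + v\<close> and \<open>u - v\<close>; the parallelogram
  law yields the new factor 2.\<close>

lemma sylvester_isometry:
  fixes z :: "nat \<Rightarrow> 'v::real_inner"
  shows "(\<Sum>j<2 ^ d. (norm (\<Sum>i<2 ^ d. sylvester d i j *\<^sub>R z i))\<^sup>2) = 2 ^ d * (\<Sum>i<2 ^ d. (norm (z i))\<^sup>2)"
proof (induction d arbitrary: z)
  case (Suc d)
  let ?n = "2 ^ d :: nat"
  let ?u = "\<lambda>j. \<Sum>i<?n. sylvester d i j *\<^sub>R z i" and ?v = "\<lambda>j. \<Sum>i<?n. sylvester d i j *\<^sub>R z (?n + i)"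
  have two: "2 ^ Suc d = ?n + ?n"
    by simp
  have 1: "(\<Sum>i<2 ^ Suc d. sylvester (Suc d) i j *\<^sub>R z i) = ?u j + ?v j" if "j < ?n" for j
    unfolding two sum_lessThan_add using that by (intro arg_cong2[of _ _ _ _ "(+)"] sum.cong) auto
  have 2: "(\<Sum>i<2 ^ Suc d. sylvester (Suc d) i (?n + j) *\<^sub>R z i) = ?u j - ?v j" if "j < ?n" for j
  proof -
    have "(\<Sum>i<2 ^ Suc d. sylvester (Suc d) i (?n + j) *\<^sub>R z i)
        = ?u j + (\<Sum>i<?n. - (sylvester d i j *\<^sub>R z (?n + i)))"
      unfolding two sum_lessThan_add using that by (intro arg_cong2[of _ _ _ _ "(+)"] sum.cong) auto
    then show ?thesis
      by (simp add: sum_negf)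
  qed
  have "(\<Sum>j<2 ^ Suc d. (norm (\<Sum>i<2 ^ Suc d. sylvester (Suc d) i j *\<^sub>R z i))\<^sup>2)
      = (\<Sum>j<?n. (norm (?u j + ?v j))\<^sup>2) + (\<Sum>j<?n. (norm (?u j - ?v j))\<^sup>2)"
  proof -
    have "(\<Sum>j<2 ^ Suc d. f j) = (\<Sum>j<?n. f j) + (\<Sum>j<?n. f (?n + j))" for f :: "nat \<Rightarrow> real"
      unfolding two by (rule sum_lessThan_add)
    then show ?thesis
      by (simp only:) (intro arg_cong2[of _ _ _ _ "(+)"] sum.cong refl; simp only: 1 2 lessThan_iff)
  qed
  also have "\<dots> = (\<Sum>j<?n. (norm (?u j + ?v j))\<^sup>2 + (norm (?u j - ?v j))\<^sup>2)"
    by (rule sum.distrib[symmetric])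
  also have "\<dots> = 2 * (\<Sum>j<?n. (norm (?u j))\<^sup>2) + 2 * (\<Sum>j<?n. (norm (?v j))\<^sup>2)"
    by (simp only: parallelogram_norm sum.distrib sum_distrib_left)
  also have "\<dots> = 2 ^ Suc d * (\<Sum>i<2 ^ Suc d. (norm (z i))\<^sup>2)"
    unfolding two sum_lessThan_add Suc by (simp add: algebra_simps)
  finally show ?case .
qed simp

text \<open>Partial sums of the form with coefficients
  \<open>h(i\<^sub>1, i\<^sub>2) h(i\<^sub>2, i\<^sub>3) \<dots> h(i\<^sub>m\<^sub>-\<^sub>1, i\<^sub>m)\<close> for \<open>h\<close> the Sylvester matrix,
  the last index being kept free.\<close>

fun chain :: "nat \<Rightarrow> (nat \<Rightarrow> nat \<Rightarrow> 'k::real_normed_field) \<Rightarrow> nat \<Rightarrow> nat \<Rightarrow> 'k"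
  where
    "chain d x 0 j = x 1 j"
  | "chain d x (Suc k) j = x (Suc (Suc k)) j * (\<Sum>i<2 ^ d. sylvester d i j *\<^sub>R chain d x k i)"

text \<open>Stage \<open>k\<close> of the chain reads the arguments \<open>1\<close> to
  \<open>k + 1\<close>, so stage \<open>m - 1\<close> has used all of them.\<close>

definition chain_form :: "nat \<Rightarrow> nat \<Rightarrow> (nat \<Rightarrow> nat \<Rightarrow> 'k::real_normed_field) \<Rightarrow> 'k"
  where "chain_form m d x = (\<Sum>j<2 ^ d. chain d x (m - 1) j)"

lemma chain_upd_later: "Suc k < j \<Longrightarrow> chain d (x(j := y)) k l = chain d x k l"
  by (induction k arbitrary: l) auto

text \<open>Each argument enters a single factor, either the newest one or one inside the previous
  stage; the case distinction follows this.\<close>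

lemma chain_linear:
  "1 \<le> j \<Longrightarrow> j \<le> Suc k \<Longrightarrow> chain d (x(j := (\<lambda>n. a * y n + b * z n))) k l
    = a * chain d (x(j := y)) k l + b * chain d (x(j := z)) k l"
proof (induction k arbitrary: l)
  case (Suc k)
  show ?case
  proof (cases "j = Suc (Suc k)")
    case True
    have "chain d (x(Suc (Suc k) := y)) k l = chain d x k l" for y l
      by (rule chain_upd_later) simp
    then show ?thesis
      unfolding True chain.simps by (simp add: algebra_simps)
  next
    case False
    then have IH: "chain d (x(j := (\<lambda>n. a * y n + b * z n))) k l
        = a * chain d (x(j := y)) k l + b * chain d (x(j := z)) k l" for l
      using Suc by (simp del: fun_upd_apply)
    have "(x(j := y)) (Suc (Suc k)) = x (Suc (Suc k))" for y
      using False by simp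
    then show ?thesis
      by (simp only: chain.simps IH)
        (simp add: scaleR_right_distrib sum.distrib sum_distrib_left algebra_simps)
  qed
qed (auto simp: le_Suc_eq)

lemma multilinear_chain_form: "1 \<le> m \<Longrightarrow> multilinear_form m (chain_form m d)"
  unfolding multilinear_form_def chain_form_def
  by (auto simp: chain_linear sum.distrib sum_distrib_left simp del: fun_upd_apply)

section \<open>Continuity of the extremal forms\<close>

lemma continuous_map_mult:
  fixes f g :: "'a \<Rightarrow> 'b::real_normed_algebra"
  assumes "continuous_map X euclidean f" "continuous_map X euclidean g"
  shows "continuous_map X euclidean (\<lambda>x. f x * g x)"
  using assms by (auto simp: continuous_map_atin intro: tendsto_mult)

lemma continuous_map_scaleR_right:
  fixes f :: "'a \<Rightarrow> 'b::real_normed_vector"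
  assumes "continuous_map X euclidean f"
  shows "continuous_map X euclidean (\<lambda>x. c *\<^sub>R f x)"
  using assms by (auto simp: continuous_map_atin intro: tendsto_scaleR)

lemma continuous_map_c0_coordinate:
  "continuous_map (mtopology_of c0_metric) euclidean (\<lambda>y :: nat \<Rightarrow> 'k::real_normed_field. y l)"
proof -
  have "norm (x l - y l) \<le> c0_dist x y" if "x \<in> c0" "y \<in> c0" for x y :: "nat \<Rightarrow> 'k"
    using norm_le_sup_norm[OF c0_diff[OF that]] by (simp add: c0_dist_def)
  then have "Lipschitz_continuous_map c0_metric euclidean_metric (\<lambda>y :: nat \<Rightarrow> 'k. y l)"
    unfolding Lipschitz_continuous_map_def
    by (auto simp: mdist_c0_metric dist_norm intro!: exI[of _ 1])
  then show ?thesis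
    using Lipschitz_continuous_imp_continuous_map by fastforce
qed

lemma continuous_map_chain:
  fixes d m :: nat
  defines "X \<equiv> product_topology (\<lambda>_. mtopology_of (c0_metric :: (nat \<Rightarrow> 'k::real_normed_field) metric)) {1..m}"
  shows "k < m \<Longrightarrow> continuous_map X euclidean (\<lambda>x. chain d x k l)"
proof -
  have coord: "continuous_map X euclidean (\<lambda>x. x j l)" if "j \<in> {1..m}" for j l
    using continuous_map_compose[OF continuous_map_product_projection[OF that]
        continuous_map_c0_coordinate[of l]]
    unfolding X_def o_def by simp
  show "k < m \<Longrightarrow> continuous_map X euclidean (\<lambda>x. chain d x k l)"
  proof (induction k arbitrary: l)
    case 0
    then show ?case
      using coord[of 1 l] by simp
  next
    case (Suc k)
    then show ?case
      unfolding chain.simps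
      by (intro continuous_map_mult coord continuous_map_sum continuous_map_scaleR_right) auto
  qed
qed

lemma continuous_multilinear_chain_form:
  "1 \<le> m \<Longrightarrow> continuous_multilinear_form m (chain_form m d)"
  unfolding continuous_multilinear_form_def
proof (intro conjI multilinear_chain_form)
  assume "1 \<le> m"
  then show "continuous_map (product_topology (\<lambda>_. mtopology_of c0_metric) {1..m}) euclidean (chain_form m d)"
    unfolding chain_form_def[abs_def] by (intro continuous_map_sum continuous_map_chain) auto
qed

text \<open>The Sylvester matrix multiplies the squared l2 norm by \<open>2 ^ d\<close> at each
  stage, while pointwise multiplication by entries of modulus at most 1 does not increase
  it.\<close>

lemma chain_L2_le:
  fixes x :: "nat \<Rightarrow> nat \<Rightarrow> 'k::{real_normed_field,real_inner}"
  assumes "\<And>j l. j \<in> {1..m} \<Longrightarrow> norm (x j l) \<le> 1"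
  shows "k < m \<Longrightarrow> (\<Sum>j<2 ^ d. (norm (chain d x k j))\<^sup>2) \<le> (2 ^ d) ^ Suc k"
proof (induction k)
  case 0
  have "(\<Sum>j<2 ^ d. (norm (x 1 j))\<^sup>2) \<le> (\<Sum>j<(2 ^ d :: nat). 1)"
    using assms[of 1] 0 by (intro sum_mono power_le_one) auto
  then show ?case
    by simp
next
  case (Suc k)
  let ?s = "\<lambda>j. \<Sum>i<2 ^ d. sylvester d i j *\<^sub>R chain d x k i"
  have "(\<Sum>j<2 ^ d. (norm (chain d x (Suc k) j))\<^sup>2) \<le> (\<Sum>j<2 ^ d. (norm (?s j))\<^sup>2)"
    using assms[of "Suc (Suc k)"] Suc.prems
    by (intro sum_mono power_mono) (auto simp: norm_mult mult_left_le_one_le)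
  also have "\<dots> = 2 ^ d * (\<Sum>j<2 ^ d. (norm (chain d x k j))\<^sup>2)"
    by (rule sylvester_isometry)
  also have "\<dots> \<le> 2 ^ d * (2 ^ d) ^ Suc k"
    using Suc by (intro mult_left_mono) auto
  finally show ?case
    by simp
qed

text \<open>Cauchy-Schwarz against the constant 1 in the free last index adds a factor
  \<open>sqrt (2 ^ d)\<close> to the l2 bound of the chain.\<close>

lemma form_norm_chain_form_le:
  assumes "1 \<le> m"
  shows "form_norm m (chain_form m d :: (nat \<Rightarrow> nat \<Rightarrow> 'k::{real_normed_field,real_inner}) \<Rightarrow> 'k)
    \<le> (2 ^ d) powr ((real m + 1) / 2)"
  unfolding form_norm_def
proof (rule cSUP_least)
  have "(\<lambda>j\<in>{1..m}. \<lambda>n. 0 :: 'k) \<in> {x \<in> tuples m. \<forall>j\<in>{1..m}. sup_norm (x j) \<le> 1}"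
    by (auto simp: tuples_def c0_def sup_norm_def)
  then show "{x \<in> tuples m. \<forall>j\<in>{1..m}. sup_norm (x j :: nat \<Rightarrow> 'k) \<le> 1} \<noteq> {}"
    by blast
next
  fix x :: "nat \<Rightarrow> nat \<Rightarrow> 'k"
  assume x: "x \<in> {x \<in> tuples m. \<forall>j\<in>{1..m}. sup_norm (x j) \<le> 1}"
  have "norm (x j l) \<le> 1" if "j \<in> {1..m}" for j l
  proof -
    have "x j \<in> c0" "sup_norm (x j) \<le> 1"
      using x that by (auto simp: tuples_def)
    then show ?thesis
      using norm_le_sup_norm[of "x j" l] by linarith
  qed
  then have L2: "(\<Sum>j<2 ^ d. (norm (chain d x (m - 1) j))\<^sup>2) \<le> (2 ^ d) ^ m"
    using chain_L2_le[of m x "m - 1" d] assms by simp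
  have "norm (chain_form m d x) \<le> (\<Sum>j<2 ^ d. \<bar>1\<bar> * \<bar>norm (chain d x (m - 1) j)\<bar>)"
    unfolding chain_form_def using norm_sum[of "chain d x (m - 1)"] by simp
  also have "\<dots> \<le> L2_set (\<lambda>_. 1) {..<2 ^ d :: nat} * L2_set (\<lambda>j. norm (chain d x (m - 1) j)) {..<2 ^ d}"
    by (rule L2_set_mult_ineq)
  also have "\<dots> \<le> sqrt (2 ^ d) * sqrt ((2 ^ d) ^ m)"
    using L2 by (simp add: L2_set_def)
  also have "\<dots> = (2 ^ d) powr ((real m + 1) / 2)"
  proof -
    have "sqrt (2 ^ d) * sqrt ((2 ^ d) ^ m) = sqrt ((2 ^ d) ^ Suc m)"
      by (simp add: real_sqrt_mult)
    also have "\<dots> = ((2 ^ d) powr real (Suc m)) powr (1 / 2)"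
      by (subst powr_realpow, simp) (rule powr_half_sqrt[symmetric], simp)
    also have "\<dots> = (2 ^ d) powr ((real m + 1) / 2)"
      unfolding powr_powr by (simp add: add.commute)
    finally show ?thesis .
  qed
  finally show "norm (chain_form m d x) \<le> (2 ^ d) powr ((real m + 1) / 2)" .
qed

text \<open>Unit vectors leave one surviving term in each sum, a product of Sylvester signs.\<close>

lemma norm_chain_unit_vec:
  fixes x :: "nat \<Rightarrow> nat \<Rightarrow> 'k::real_normed_field"
  assumes "\<And>j. j \<in> {1..m} \<Longrightarrow> x j = unit_vec (i j)" "\<And>j. j \<in> {1..m} \<Longrightarrow> i j < 2 ^ d" "k < m"
  shows "norm (chain d x k l) = (if l = i (Suc k) then 1 else 0)"
  using assms(3)
proof (induction k arbitrary: l)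
  case 0
  then show ?case
    using assms(1)[of 1] by (simp add: unit_vec_def)
next
  case (Suc k)
  have IH: "norm (chain d x k n) = (if n = i (Suc k) then 1 else 0)" for n
    using Suc by simp
  then have "chain d x k n = 0" if "n \<noteq> i (Suc k)" for n
    using that by (metis norm_eq_zero)
  then have "(\<Sum>n<2 ^ d. sylvester d n l *\<^sub>R chain d x k n) = (\<Sum>n\<in>{i (Suc k)}. sylvester d n l *\<^sub>R chain d x k n)"
    using assms(2)[of "Suc k"] Suc.prems by (intro sum.mono_neutral_right) auto
  then have "norm (\<Sum>n<2 ^ d. sylvester d n l *\<^sub>R chain d x k n) = 1"
    using IH by simp
  then show ?case
    using Suc.prems assms(1)[of "Suc (Suc k)"] by (simp add: unit_vec_def norm_mult)
qed

lemma norm_chain_form_unit_vec: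
  fixes x :: "nat \<Rightarrow> nat \<Rightarrow> 'k::real_normed_field"
  assumes "\<And>j. j \<in> {1..m} \<Longrightarrow> x j = unit_vec (i j)" "\<And>j. j \<in> {1..m} \<Longrightarrow> i j < 2 ^ d" "1 \<le> m"
  shows "norm (chain_form m d x) = 1"
proof -
  let ?c = "chain d x (m - 1)"
  have c: "norm (?c l) = (if l = i m then 1 else 0)" for l
    using norm_chain_unit_vec[OF assms(1,2), where k = "m - 1" and l = l] assms(3) by simp
  then have "?c l = 0" if "l \<noteq> i m" for l
    using that by (metis norm_eq_zero)
  then have "chain_form m d x = (\<Sum>l\<in>{i m}. ?c l)"
    unfolding chain_form_def using assms by (intro sum.mono_neutral_right) auto
  then show ?thesis
    using c by simp
qed

text \<open>Each series is cut to its first \<open>n\<close> terms. If level \<open>k + 1\<close> is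
  at least \<open>n powr E\<close>, then level \<open>k\<close> is at least
  \<open>n powr (1 + E * q k / q (Suc k))\<close>; this recursion is solved by \<open>q k\<close>
  times the sum of the reciprocals from \<open>k\<close> on.\<close>

lemma nested_sum_ge:
  assumes "k \<le> m" "1 \<le> k" "\<And>j. j \<in> {1..m} \<Longrightarrow> 0 < q j" "1 \<le> n"
    and "\<And>j. j \<in> {1..<k} \<Longrightarrow> i j < n"
    and "\<And>i. (\<And>j. j \<in> {1..m} \<Longrightarrow> i j < n) \<Longrightarrow> a i = 1"
  shows "ennreal (real n powr (q k * (\<Sum>j=k..m. 1 / q j))) \<le> nested_sum m q a k i"
  using assms(1,2,5)
proof (induction k arbitrary: i rule: inc_induct)
  case base
  have "ennreal (real n powr (q m * (\<Sum>j=m..m. 1 / q j))) = (\<Sum>l<n. ennpow (ennreal (a (i(m := l)))) (q m))"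
  proof -
    have "a (i(m := l)) = 1" if "l < n" for l
      using that base by (intro assms(6)) auto
    then have "(\<Sum>l<n. ennpow (ennreal (a (i(m := l)))) (q m)) = (\<Sum>l<n. ennreal 1)"
      by (intro sum.cong) (auto simp: ennpow_def)
    then show ?thesis
      using assms(3)[of m] assms(4) base by (simp add: ennreal_of_nat_eq_real_of_nat)
  qed
  also have "\<dots> \<le> (\<Sum>l. ennpow (ennreal (a (i(m := l)))) (q m))"
    by (rule sum_le_suminf) auto
  finally show ?case
    by (subst nested_sum.simps) simp
next
  case (step k)
  let ?r = "q k / q (Suc k)" and ?s = "\<Sum>j=Suc k..m. 1 / q j"
  have q: "0 < q k" "0 < q (Suc k)"
    using assms(3) step by auto
  have exponent: "q k * (\<Sum>j=k..m. 1 / q j) = 1 + q (Suc k) * ?s * ?r"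
    using q step.hyps by (simp add: sum.atLeast_Suc_atMost[of k m] distrib_left)
  have "ennreal (real n powr (q k * (\<Sum>j=k..m. 1 / q j)))
      = (\<Sum>l<n. ennreal ((real n powr (q (Suc k) * ?s)) powr ?r))"
    using assms(4) unfolding exponent
    by (simp add: powr_add powr_powr ennreal_mult ennreal_of_nat_eq_real_of_nat)
  also have "\<dots> \<le> (\<Sum>l<n. ennpow (nested_sum m q a (Suc k) (i(k := l))) ?r)"
  proof (rule sum_mono)
    fix l assume "l \<in> {..<n}"
    then have "ennreal (real n powr (q (Suc k) * ?s)) \<le> nested_sum m q a (Suc k) (i(k := l))"
      using step.prems by (intro step.IH) (auto simp: less_Suc_eq)
    then have "ennpow (ennreal (real n powr (q (Suc k) * ?s))) ?r
        \<le> ennpow (nested_sum m q a (Suc k) (i(k := l))) ?r"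
      using q by (intro ennpow_mono) auto
    then show "ennreal ((real n powr (q (Suc k) * ?s)) powr ?r)
        \<le> ennpow (nested_sum m q a (Suc k) (i(k := l))) ?r"
      by (simp add: ennpow_ennreal)
  qed
  also have "\<dots> \<le> (\<Sum>l. ennpow (nested_sum m q a (Suc k) (i(k := l))) ?r)"
    by (rule sum_le_suminf) auto
  also have "\<dots> = nested_sum m q a k i"
    using step.hyps by (subst (2) nested_sum.simps) simp
  finally show ?case .
qed

lemma mixed_sum_chain_form_ge:
  assumes "1 \<le> m" "\<And>j. j \<in> {1..m} \<Longrightarrow> 0 < q j"
  shows "ennreal ((2 ^ d) powr (\<Sum>j=1..m. 1 / q j))
    \<le> mixed_sum m q (chain_form m d :: (nat \<Rightarrow> nat \<Rightarrow> 'k::real_normed_field) \<Rightarrow> 'k)"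
proof -
  let ?a = "\<lambda>i. norm (chain_form m d (\<lambda>j\<in>{1..m}. unit_vec (i j) :: nat \<Rightarrow> 'k))"
  let ?s = "\<Sum>j=1..m. 1 / q j"
  have q: "0 < q 1"
    using assms by simp
  have "ennreal (real (2 ^ d) powr (q 1 * ?s)) \<le> nested_sum m q ?a 1 (\<lambda>_. 0)"
    using assms by (intro nested_sum_ge norm_chain_form_unit_vec[where m = m]) auto
  then have "ennpow (ennreal (real (2 ^ d) powr (q 1 * ?s))) (1 / q 1) \<le> mixed_sum m q (chain_form m d :: (nat \<Rightarrow> nat \<Rightarrow> 'k) \<Rightarrow> 'k)"
    unfolding mixed_sum_def using q by (intro ennpow_mono) auto
  then show ?thesis
    using q by (simp add: ennpow_ennreal powr_powr)
qed

text \<open>The sort constraint is met by both \<open>real\<close> and \<open>complex\<close>, so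
  that one argument serves both scalar fields.\<close>

lemma mixed_inequality_iff:
  assumes "1 \<le> m" "\<And>j. j \<in> {1..m} \<Longrightarrow> q j \<in> {1..2}"
  shows "(\<exists>C\<ge>1. \<forall>A :: (nat \<Rightarrow> nat \<Rightarrow> 'k::{real_normed_field,real_inner}) \<Rightarrow> 'k.
      continuous_multilinear_form m A \<longrightarrow> mixed_sum m q A \<le> ennreal (C * form_norm m A))
    \<longleftrightarrow> (\<Sum>j=1..m. 1 / q j) \<le> (real m + 1) / 2"
proof
  assume "(\<Sum>j=1..m. 1 / q j) \<le> (real m + 1) / 2"
  then show "\<exists>C\<ge>1. \<forall>A :: (nat \<Rightarrow> nat \<Rightarrow> 'k) \<Rightarrow> 'k.
      continuous_multilinear_form m A \<longrightarrow> mixed_sum m q A \<le> ennreal (C * form_norm m A)"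
    using mixed_sum_le[OF _ assms] by (intro exI[of _ "(9/2) ^ (m - 1)"]) auto
next
  let ?s = "\<Sum>j=1..m. 1 / q j" and ?t = "(real m + 1) / 2"
  assume "\<exists>C\<ge>1. \<forall>A :: (nat \<Rightarrow> nat \<Rightarrow> 'k) \<Rightarrow> 'k.
      continuous_multilinear_form m A \<longrightarrow> mixed_sum m q A \<le> ennreal (C * form_norm m A)"
  then obtain C where "1 \<le> C" and C: "\<And>A :: (nat \<Rightarrow> nat \<Rightarrow> 'k) \<Rightarrow> 'k.
      continuous_multilinear_form m A \<Longrightarrow> mixed_sum m q A \<le> ennreal (C * form_norm m A)"
    by blast
  have qpos: "0 < q j" if "j \<in> {1..m}" for j
    using assms(2)[OF that] by auto
  \<comment> \<open>For the chain form, the coefficient sum and the norm differ by a factor that is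
    at least a \<open>d\<close>-th power; \<open>C\<close> does not depend on \<open>d\<close>, so
    the base cannot exceed 1.\<close>
  have bound: "(2 powr (?s - ?t)) ^ d \<le> C" for d
  proof -
    let ?A = "chain_form m d :: (nat \<Rightarrow> nat \<Rightarrow> 'k) \<Rightarrow> 'k"
    have "ennreal ((2 ^ d) powr ?s) \<le> mixed_sum m q ?A"
      using assms(1) qpos by (rule mixed_sum_chain_form_ge)
    also have "\<dots> \<le> ennreal (C * form_norm m ?A)"
      using assms(1) by (intro C continuous_multilinear_chain_form)
    also have "\<dots> \<le> ennreal (C * (2 ^ d) powr ?t)"
      using assms(1) \<open>1 \<le> C\<close> by (intro ennreal_leI mult_left_mono form_norm_chain_form_le) auto
    finally have "(2 ^ d) powr ?s \<le> C * (2 ^ d) powr ?t"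
      using \<open>1 \<le> C\<close> by (simp add: ennreal_le_iff)
    then have "(2 ^ d) powr (?s - ?t) \<le> C"
      unfolding powr_diff by (subst pos_divide_le_eq) auto
    moreover have "(2 ^ d) powr (?s - ?t) = (2 powr (?s - ?t)) ^ d"
      by (simp add: powr_realpow[symmetric] powr_powr mult.commute)
    ultimately show ?thesis
      by simp
  qed
  show "?s \<le> ?t"
  proof (rule ccontr)
    assume "\<not> ?s \<le> ?t"
    then have "1 < 2 powr (?s - ?t)"
      by simp
    then obtain d where "C < (2 powr (?s - ?t)) ^ d"
      using real_arch_pow by blast
    then show False
      using bound[of d] by linarith
  qed
qed

theorem theorem1p1:
  fixes m :: nat and q :: "nat \<Rightarrow> real"
  assumes "m \<ge> 1"
    and "\<forall>j\<in>{1..m}. q j \<in> {1..2}"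
  shows
    "((\<exists>C\<ge>1. \<forall>A :: (nat \<Rightarrow> nat \<Rightarrow> real) \<Rightarrow> real.
         continuous_multilinear_form m A \<longrightarrow> mixed_sum m q A \<le> ennreal (C * form_norm m A))
      \<longleftrightarrow> (\<Sum>j=1..m. 1 / q j) \<le> (real m + 1) / 2)
   \<and> ((\<exists>C\<ge>1. \<forall>A :: (nat \<Rightarrow> nat \<Rightarrow> complex) \<Rightarrow> complex.
         continuous_multilinear_form m A \<longrightarrow> mixed_sum m q A \<le> ennreal (C * form_norm m A))
      \<longleftrightarrow> (\<Sum>j=1..m. 1 / q j) \<le> (real m + 1) / 2)"
  using assms by (intro conjI mixed_inequality_iff) auto

end
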